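(* Let $\kappa$ be a regular uncountable cardinal with $\kappa^{<\kappa}=\kappa$, let $\xi\le\kappa$ be an ordinal, $\mu,\nu,\theta\le\kappa$ cardinals, $\mathcal S$ a nonempty collection of stationary subsets of $\kappa$, and let $\mathcal R$ be one of the relation-names in the family $\mathfrak F$ below. Suppose that $\mathrm P^-_\xi(\kappa,\mu,\mathcal R,\theta,\mathcal S,\nu)$ holds (with $\mathcal R$ interpreted on $\mathcal K(\kappa)$). Let $\vec B=\langle B_\iota\mid\iota<\kappa\rangle$ be any partition of $\kappa$ into stationary sets. Then there exists a sequence $\langle\mathcal C_\alpha\mid\alpha<\kappa\rangle$ that, together with $\vec B$, witnesses $\mathrm P^\bullet_\xi(\kappa,\mu,\mathcal R,\theta,\mathcal S,\nu)$ (with $\mathcal R$ interpreted on $\mathcal F(\kappa)$).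
   Context: $H_\kappa$: sets of hereditary cardinality $<\kappa$. Notation: $\mathrm{acc}(C):=\{\alpha\in C\mid\sup(C\cap\alpha)=\alpha>0\}$, $\mathrm{nacc}(C):=C\setminus\mathrm{acc}(C)$; $C(j)$ is the $j$-th element of a set of ordinals $C$; $\mathrm{succ}_n(C):=\{C(j+1)\mid j<n,\ j+1<\mathrm{otp}(C)\}$; $\mathrm{acc}(\kappa)$: nonzero limit ordinals below $\kappa$. $\mathcal K(\kappa)$: nonempty $x\subseteq\kappa$ club in $\sup(x)$ with $\sup(x)\notin x$; $\alpha_x:=\sup(x)$. $\mathcal F(\kappa)$: functions $C$ with $\partial C:=\mathrm{dom}(C)\in\mathcal K(\kappa)$ and values in $H_\kappa$; $\alpha_C:=\sup(\partial C)$. Relations on $\mathcal K(\kappa)$: $C\sqsubseteq D$ iff $C=D\cap\alpha_C$; $C\sqsubseteq^*D$ iff $\exists\gamma<\alpha_C$ with $C\setminus\gamma\sqsubseteq D\setminus\gamma$. Relations on $\mathcal F(\kappa)$: $C\sqsubseteq D$ iff $C=D\restriction\alpha_C$; $C\sqsubseteq^*D$ iff $\exists\gamma<\alpha_C$ with $C\restriction(\partial C\setminus\gamma)\sqsubseteq D\restriction(\partial D\setminus\gamma)$. In both settings, for $\mathcal R'\in\{\sqsubseteq,\sqsubseteq^*\}$ and cardinal $\chi$: $C\,{}_\chi\mathcal R'\,D$ iff ($C\,\mathcal R'\,D$ or $\mathrm{cf}(\alpha_C)<\chi$); $C\,\mathcal R'_\chi\,D$ iff ($C\,\mathcal R'\,D$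 or ($\mathrm{otp}(\underline D)<\chi$ and $\mathrm{nacc}(\underline D)$ consists of successor ordinals)), where $\underline D$ is $D$ itself (for $\mathcal K(\kappa)$) or $\partial D$ (for $\mathcal F(\kappa)$); for a class $\Omega$, $C\,{}^\Omega\mathcal R'\,D$ iff ($C\,\mathcal R'\,D$ and $\alpha_C\notin\Omega$). The family $\mathfrak F$: $\sqsubseteq,\sqsubseteq^*,{}_\chi\sqsubseteq,{}_\chi\sqsubseteq^*,\sqsubseteq_\chi,\sqsubseteq^*_\chi$ and ${}^\Omega\mathcal R'$ for such $\mathcal R'$. $\mathrm P^-_\xi(\kappa,\mu,\mathcal R,\theta,\mathcal S,\nu)$: there is $\langle\mathcal C_\alpha\mid\alpha<\kappa\rangle$ with, for $\alpha\in\mathrm{acc}(\kappa)$, $\mathcal C_\alpha\subseteq\{C\in\mathcal K(\kappa)\mid\mathrm{otp}(C)\le\xi,\alpha_C=\alpha\}$, $0<|\mathcal C_\alpha|<\mu$, for $C\in\mathcal C_\alpha$ and $\bar\alpha\in\mathrm{acc}(C)$ some $D\in\mathcal C_{\bar\alpha}$ with $D\,\mathcal R\,C$; and for every $\langle B_i\mid i<\theta\rangle$ of cofinal subsets of $\kappa$, every $S\in\mathcal S$ and every $n<\omega$, stationarily many $\alpha\in S$ with $|\mathcal C_\alpha|<\nu$ and $\sup\{\gamma\in C\mid\mathrm{succ}_n(C\setminus\gamma)\subseteq B_i\}=\alpha$ for all $C\in\mathcal C_\alpha$, $i<\min\{\alpha,\theta\}$. For $B\subseteq\kappa,\Omega\subseteq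 H_\kappa,p\in H_{\kappa^+},C\in\mathcal F(\kappa)$: $B(\Omega,p,C)$ is the set of $\beta\in B\cap\partial C$ such that some $\mathcal M\prec H_{\kappa^+}$ has $p\in\mathcal M$, $\mathcal M\cap\kappa=\beta$, $\mathcal M\cap\Omega=C(\beta)$. A sequence $\langle\mathcal C_\alpha\rangle$ and partition $\langle B_\iota\mid\iota<\kappa\rangle$ witness $\mathrm P^\bullet_\xi(\kappa,\mu,\mathcal R,\theta,\mathcal S,\nu)$ if for $\alpha\in\mathrm{acc}(\kappa)$: $\mathcal C_\alpha\subseteq\{C\in\mathcal F(\kappa)\mid\mathrm{otp}(\partial C)\le\xi,\alpha_C=\alpha\}$, $0<|\mathcal C_\alpha|<\mu$, for $C\in\mathcal C_\alpha$ and $\bar\alpha\in\mathrm{acc}(\partial C)$ some $D\in\mathcal C_{\bar\alpha}$ has $D\,\mathcal R\,C$; and for every $\langle(\Omega_i,p_i,\iota_i)\mid i<\theta\rangle\in(\mathcal P(H_\kappa)\times H_{\kappa^+}\times\kappa)^\theta$, every $S\in\mathcal S$, every $n<\omega$, stationarily many $\alpha\in S$ have $|\mathcal C_\alpha|<\nu$ and $\sup\{\gamma\in\partial C\mid\mathrm{succ}_n(\partial C\setminus\gamma)\subseteq B_{\iota_i}(\Omega_i,p_i,C)\}=\alpha$ for all $C\in\mathcal C_\alpha$, $i<\min\{\alpha,\theta\}$. *)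

theory Defs
  imports "HOL-Library.Disjoint_Sets" "HOL-Library.Countable_Set"
begin

unbundle cardinal_syntax

section \<open>A universe of sets\<close>

text \<open>
  The type \<open>'k hset\<close> consists of the (well-founded, extensional) sets that are hereditarily
  of cardinality at most that of the type \<open>'k\<close>: well-founded trees with \<open>'k\<close>-indexed branching,
  modulo extensional equality. The lemmas \<open>elems_inject\<close>, \<open>wf_mem\<close> and \<open>ex_elems_iff\<close> determine it
  up to isomorphism. As \<open>'k\<close> is arbitrary, any given sets belong to such a
  universe. Ordinals are von Neumann ordinals of this universe, cardinals are initial ordinals.
\<close>

datatype 'k tree = Leaf | Node "'k \<Rightarrow> 'k tree"

primrec children :: "'k tree \<Rightarrow> 'k tree set" where
  "children Leaf = {}"
| "children (Node f) = range f"

primrec teq :: "'k tree \<Rightarrow> 'k tree \<Rightarrow> bool" where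
  "teq Leaf = (\<lambda>t. children t = {})"
| "teq (Node f) = (\<lambda>t. (\<forall>i. \<exists>y\<in>children t. teq (f i) y) \<and> (\<forall>y\<in>children t. \<exists>i. teq (f i) y))"

lemma teq_iff:
  "teq s t \<longleftrightarrow> (\<forall>x\<in>children s. \<exists>y\<in>children t. teq x y) \<and> (\<forall>y\<in>children t. \<exists>x\<in>children s. teq x y)"
  by (cases s) auto

lemma teq_refl: "teq t t"
  by (induction t) (auto simp: teq_iff[of "Node _"])

lemma teq_sym: "teq s t \<Longrightarrow> teq t s"
proof (induction s arbitrary: t)
  case Leaf
  then show ?case by (cases t) auto
next
  case (Node f)
  show ?case
    unfolding teq_iff[of t] using Node.prems Node.IH by fastforce
qed

lemma teq_trans: "teq s t \<Longrightarrow> teq t u \<Longrightarrow> teq s u"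
proof (induction s arbitrary: t u)
  case Leaf
  then show ?case by (cases t; cases u) auto
next
  case (Node f)
  have IH: "teq x y \<Longrightarrow> teq y z \<Longrightarrow> teq x z" if "x \<in> children (Node f)" for x y z
    using Node.IH that by auto
  have a: "\<forall>x\<in>children (Node f). \<exists>y\<in>children t. teq x y" "\<forall>y\<in>children t. \<exists>x\<in>children (Node f). teq x y"
    using Node.prems(1) unfolding teq_iff[of "Node f"] by blast+
  have b: "\<forall>x\<in>children t. \<exists>y\<in>children u. teq x y" "\<forall>y\<in>children u. \<exists>x\<in>children t. teq x y"
    using Node.prems(2) unfolding teq_iff[of t] by blast+
  show ?case
    unfolding teq_iff[of "Node f"] using a b IH by meson
qed

quotient_type 'k hset = "'k tree" / teq
  by (intro equivpI reflpI sympI transpI) (auto intro: teq_refl teq_sym teq_trans)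

definition elems :: "'k hset \<Rightarrow> 'k hset set" where
  "elems x = abs_hset ` children (rep_hset x)"

lemma abs_hset_eq_iff: "abs_hset s = abs_hset t \<longleftrightarrow> teq s t"
  using Quotient3_rel_abs[OF Quotient3_hset] Quotient3_rel[OF Quotient3_hset] teq_refl by metis

lemma elems_abs_hset: "elems (abs_hset t) = abs_hset ` children t"
proof -
  have "teq (rep_hset (abs_hset t)) t"
    by (metis abs_hset_eq_iff Quotient3_abs_rep[OF Quotient3_hset])
  then show ?thesis
    unfolding elems_def teq_iff[of _ t] by (auto simp: image_iff abs_hset_eq_iff) (metis teq_sym)
qed

lemma elems_inject: "elems x = elems y \<longleftrightarrow> x = y"
proof
  assume eq: "elems x = elems y"
  have "teq (rep_hset x) (rep_hset y)"
    unfolding teq_iff[of "rep_hset x"]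
  proof (intro conjI ballI)
    fix s assume "s \<in> children (rep_hset x)"
    then have "abs_hset s \<in> elems y" using eq by (auto simp: elems_def)
    then show "\<exists>t\<in>children (rep_hset y). teq s t"
      by (auto simp: elems_def abs_hset_eq_iff)
  next
    fix t assume "t \<in> children (rep_hset y)"
    then have "abs_hset t \<in> elems x" using eq by (auto simp: elems_def)
    then show "\<exists>s\<in>children (rep_hset x). teq s t"
      unfolding elems_def image_iff abs_hset_eq_iff using teq_sym by blast
  qed
  then show "x = y"
    by (metis abs_hset_eq_iff Quotient3_abs_rep[OF Quotient3_hset])
qed simp

definition mem :: "'k hset rel" where
  "mem = {(x, y). x \<in> elems y}"

lemma wf_mem: "wf (mem :: 'k hset rel)"
proof (rule wfUNIVI)
  fix P :: "'k hset \<Rightarrow> bool" and x :: "'k hset"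
  assume step: "\<forall>x. (\<forall>y. (y, x) \<in> mem \<longrightarrow> P y) \<longrightarrow> P x"
  have "P (abs_hset t)" for t
  proof (induction t)
    case Leaf
    show ?case by (rule step[rule_format]) (simp add: mem_def elems_abs_hset)
  next
    case (Node f)
    show ?case by (rule step[rule_format]) (use Node in \<open>auto simp: mem_def elems_abs_hset\<close>)
  qed
  then show "P x" by (metis Quotient3_abs_rep[OF Quotient3_hset])
qed

lemma ex_elems_iff: "(\<exists>x :: 'k hset. elems x = X) \<longleftrightarrow> |X| \<le>o |UNIV :: 'k set|"
proof
  assume "\<exists>x :: 'k hset. elems x = X"
  then obtain t :: "'k tree" where X: "X = abs_hset ` children t"
    by (auto simp: elems_def)
  show "|X| \<le>o |UNIV :: 'k set|"
  proof (cases t)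
    case Leaf
    then show ?thesis by (simp add: X card_of_empty)
  next
    case (Node f)
    then have "X = (abs_hset \<circ> f) ` UNIV" by (auto simp: X)
    then show ?thesis by (simp only: card_of_image)
  qed
next
  assume le: "|X| \<le>o |UNIV :: 'k set|"
  show "\<exists>x :: 'k hset. elems x = X"
  proof (cases "X = {}")
    case True
    have "elems (abs_hset Leaf) = {}" by (simp add: elems_abs_hset)
    then show ?thesis using True by blast
  next
    case False
    then obtain g :: "'k \<Rightarrow> 'k hset" where g: "range g = X"
      using le card_of_ordLeq2 by metis
    have "abs_hset (rep_hset y) = y" for y :: "'k hset"
      by (rule Quotient3_abs_rep[OF Quotient3_hset])
    then have "elems (abs_hset (Node (rep_hset \<circ> g))) = X"
      using g by (auto simp: elems_abs_hset image_iff)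
    then show ?thesis by blast
  qed
qed

definition hset_of :: "'k hset set \<Rightarrow> 'k hset" where
  "hset_of X = (THE x. elems x = X)"

definition tc :: "'k hset \<Rightarrow> 'k hset set" where
  "tc x = {y. (y, x) \<in> mem\<^sup>+}"

definition Hered :: "'a rel \<Rightarrow> 'k hset set" where
  "Hered r = {x. |tc x| <o r}"

abbreviation H :: "'k hset \<Rightarrow> 'k hset set" where
  "H \<kappa> \<equiv> Hered |elems \<kappa>|"

abbreviation Hplus :: "'k hset \<Rightarrow> 'k hset set" where
  "Hplus \<kappa> \<equiv> Hered (cardSuc |elems \<kappa>| )"


section \<open>Ordinals and cardinals\<close>

definition Ord :: "'k hset \<Rightarrow> bool" where
  "Ord x \<longleftrightarrow> (\<forall>y\<in>elems x. elems y \<subseteq> elems x) \<and> (\<forall>y\<in>elems x. \<forall>z\<in>elems y. elems z \<subseteq> elems y)"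

definition Cardinal :: "'k hset \<Rightarrow> bool" where
  "Cardinal x \<longleftrightarrow> Ord x \<and> (\<forall>y\<in>elems x. |elems y| <o |elems x| )"

definition ole :: "'k hset \<Rightarrow> 'k hset \<Rightarrow> bool" where
  "ole \<alpha> \<beta> \<longleftrightarrow> \<alpha> \<in> elems \<beta> \<or> \<alpha> = \<beta>"

definition ozero :: "'k hset" where
  "ozero = hset_of {}"

definition osucc :: "'k hset \<Rightarrow> 'k hset" where
  "osucc \<alpha> = hset_of (insert \<alpha> (elems \<alpha>))"

definition ord_of_nat :: "nat \<Rightarrow> 'k hset" where
  "ord_of_nat n = (osucc ^^ n) ozero"

definition osup :: "'k hset set \<Rightarrow> 'k hset" where
  "osup A = hset_of (\<Union>a\<in>A. elems a)"

definition otp :: "'k hset set \<Rightarrow> 'k hset" where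
  "otp A = (THE \<alpha>. Ord \<alpha> \<and>
     (\<exists>f. bij_betw f A (elems \<alpha>) \<and> (\<forall>x\<in>A. \<forall>y\<in>A. x \<in> elems y \<longleftrightarrow> f x \<in> elems (f y))))"

definition cf :: "'k hset \<Rightarrow> 'k hset" where
  "cf \<delta> = (THE \<rho>.
     (\<exists>A. A \<subseteq> elems \<delta> \<and> (\<forall>\<beta>\<in>elems \<delta>. \<exists>a\<in>A. ole \<beta> a) \<and> otp A = \<rho>) \<and>
     (\<forall>A. A \<subseteq> elems \<delta> \<and> (\<forall>\<beta>\<in>elems \<delta>. \<exists>a\<in>A. ole \<beta> a) \<longrightarrow> ole \<rho> (otp A)))"

definition regular_uncountable :: "'k hset \<Rightarrow> bool" where
  "regular_uncountable \<kappa> \<longleftrightarrow> Cardinal \<kappa> \<and> cf \<kappa> = \<kappa> \<and> uncountable (elems \<kappa>)"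

text \<open>\<open>seqs_below \<kappa>\<close> is the set of functions from some ordinal below \<open>\<kappa>\<close> to \<open>\<kappa>\<close>, so its cardinality
  is \<open>\<kappa>\<close> to the power \<open><\<kappa>\<close>.\<close>

definition seqs_below :: "'k hset \<Rightarrow> ('k hset \<rightharpoonup> 'k hset) set" where
  "seqs_below \<kappa> = {f. (\<exists>\<alpha>\<in>elems \<kappa>. dom f = elems \<alpha>) \<and> ran f \<subseteq> elems \<kappa>}"

definition acc :: "'k hset set \<Rightarrow> 'k hset set" where
  "acc C = {\<alpha>\<in>C. osup (C \<inter> elems \<alpha>) = \<alpha> \<and> ozero \<in> elems \<alpha>}"

definition nacc :: "'k hset set \<Rightarrow> 'k hset set" where
  "nacc C = C - acc C"

text \<open>The \<open>j\<close>-th element of a set of ordinals.\<close>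

definition elt :: "'k hset set \<Rightarrow> 'k hset \<Rightarrow> 'k hset" where
  "elt C j = (THE \<delta>. \<delta> \<in> C \<and> otp (C \<inter> elems \<delta>) = j)"

definition succ_n :: "nat \<Rightarrow> 'k hset set \<Rightarrow> 'k hset set" where
  "succ_n n C = {elt C (ord_of_nat (Suc j)) |j. j < n \<and> ord_of_nat (Suc j) \<in> elems (otp C)}"

definition cofinal_in :: "'k hset \<Rightarrow> 'k hset set \<Rightarrow> bool" where
  "cofinal_in \<delta> A \<longleftrightarrow> A \<subseteq> elems \<delta> \<and> osup A = \<delta>"

definition club_in :: "'k hset \<Rightarrow> 'k hset set \<Rightarrow> bool" where
  "club_in \<delta> C \<longleftrightarrow> cofinal_in \<delta> C \<and>
     (\<forall>\<beta>\<in>elems \<delta>. ozero \<in> elems \<beta> \<and> osup (C \<inter> elems \<beta>) = \<beta> \<longrightarrow> \<beta> \<in> C)"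

definition stationary_in :: "'k hset \<Rightarrow> 'k hset set \<Rightarrow> bool" where
  "stationary_in \<kappa> S \<longleftrightarrow> S \<subseteq> elems \<kappa> \<and> (\<forall>E. club_in \<kappa> E \<longrightarrow> S \<inter> E \<noteq> {})"

definition is_partition :: "'k hset \<Rightarrow> ('k hset \<Rightarrow> 'k hset set) \<Rightarrow> bool" where
  "is_partition \<kappa> B \<longleftrightarrow> disjoint_family_on B (elems \<kappa>) \<and> (\<Union>\<iota>\<in>elems \<kappa>. B \<iota>) = elems \<kappa> \<and>
     (\<forall>\<iota>\<in>elems \<kappa>. B \<iota> \<noteq> {})"


section \<open>Elementary submodels\<close>

datatype fm = Mem nat nat | Equal nat nat | Neg fm | Conj fm fm | Forall nat fm

primrec sat :: "'k hset set \<Rightarrow> fm \<Rightarrow> (nat \<Rightarrow> 'k hset) \<Rightarrow> bool" where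
  "sat M (Mem i j) s \<longleftrightarrow> s i \<in> elems (s j)"
| "sat M (Equal i j) s \<longleftrightarrow> s i = s j"
| "sat M (Neg \<phi>) s \<longleftrightarrow> \<not> sat M \<phi> s"
| "sat M (Conj \<phi> \<psi>) s \<longleftrightarrow> sat M \<phi> s \<and> sat M \<psi> s"
| "sat M (Forall i \<phi>) s \<longleftrightarrow> (\<forall>x\<in>M. sat M \<phi> (s(i := x)))"

definition elem_submodel :: "'k hset set \<Rightarrow> 'k hset set \<Rightarrow> bool" (infix "\<prec>" 50) where
  "M \<prec> N \<longleftrightarrow> M \<noteq> {} \<and> M \<subseteq> N \<and> (\<forall>\<phi> s. range s \<subseteq> M \<longrightarrow> (sat M \<phi> s \<longleftrightarrow> sat N \<phi> s))"


section \<open>The classes \<open>\<K>(\<kappa>)\<close> and \<open>\<F>(\<kappa>)\<close> and relations on them\<close>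

definition KK :: "'k hset \<Rightarrow> 'k hset set set" where
  "KK \<kappa> = {x. x \<noteq> {} \<and> x \<subseteq> elems \<kappa> \<and> club_in (osup x) x \<and> osup x \<notin> x}"

definition FF :: "'k hset \<Rightarrow> ('k hset \<rightharpoonup> 'k hset) set" where
  "FF \<kappa> = {C. dom C \<in> KK \<kappa> \<and> ran C \<subseteq> H \<kappa>}"

definition sqK :: "'k hset set \<Rightarrow> 'k hset set \<Rightarrow> bool" where
  "sqK C D \<longleftrightarrow> C = D \<inter> elems (osup C)"

definition sqK_star :: "'k hset set \<Rightarrow> 'k hset set \<Rightarrow> bool" where
  "sqK_star C D \<longleftrightarrow> (\<exists>\<gamma>\<in>elems (osup C). sqK (C - elems \<gamma>) (D - elems \<gamma>))"

definition sqF :: "('k hset \<rightharpoonup> 'k hset) \<Rightarrow> ('k hset \<rightharpoonup> 'k hset) \<Rightarrow> bool" where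
  "sqF C D \<longleftrightarrow> C = D |` elems (osup (dom C))"

definition sqF_star :: "('k hset \<rightharpoonup> 'k hset) \<Rightarrow> ('k hset \<rightharpoonup> 'k hset) \<Rightarrow> bool" where
  "sqF_star C D \<longleftrightarrow>
     (\<exists>\<gamma>\<in>elems (osup (dom C)). sqF (C |` (dom C - elems \<gamma>)) (D |` (dom D - elems \<gamma>)))"

text \<open>
  Names for the relations. \<open>Sq\<close> and \<open>SqStar\<close> name \<open>\<sqsubseteq>\<close> and its starred version;
  \<open>LeftChi \<chi> R\<close> and \<open>RightChi R \<chi>\<close> put the cardinal \<open>\<chi>\<close> as left, respectively right, subscript
  of \<open>R\<close>; \<open>Avoid \<Omega> R\<close> has \<open>\<Omega>\<close> as left superscript. Only the ordinals in the class \<open>\<Omega>\<close> matter,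
  so a set of elements of the universe suffices for it.
\<close>

datatype sq_name = Sq | SqStar

datatype 'v chi_name = Plain sq_name | LeftChi 'v sq_name | RightChi sq_name 'v

datatype 'v rel_name = Simple "'v chi_name" | Avoid "'v set" "'v chi_name"

primrec chi_valid :: "'k hset chi_name \<Rightarrow> bool" where
  "chi_valid (Plain R) \<longleftrightarrow> True"
| "chi_valid (LeftChi \<chi> R) \<longleftrightarrow> Cardinal \<chi>"
| "chi_valid (RightChi R \<chi>) \<longleftrightarrow> Cardinal \<chi>"

definition rel_family :: "'k hset rel_name set" where
  "rel_family = {Simple R |R. chi_valid R} \<union> {Avoid \<Omega> R |\<Omega> R. chi_valid R}"

text \<open>
  Interpretation of names over a class of objects of type \<open>'x\<close>, given the interpretations \<open>sq\<close>,
  \<open>sq_star\<close> of the two basic relations and the map \<open>u\<close> sending an object to its underlying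
  set of ordinals.
\<close>

context
  fixes sq sq_star :: "'x \<Rightarrow> 'x \<Rightarrow> bool" and u :: "'x \<Rightarrow> 'k hset set"
begin

primrec sq_interp :: "sq_name \<Rightarrow> 'x \<Rightarrow> 'x \<Rightarrow> bool" where
  "sq_interp Sq = sq"
| "sq_interp SqStar = sq_star"

primrec chi_interp :: "'k hset chi_name \<Rightarrow> 'x \<Rightarrow> 'x \<Rightarrow> bool" where
  "chi_interp (Plain R) = sq_interp R"
| "chi_interp (LeftChi \<chi> R) = (\<lambda>C D. sq_interp R C D \<or> cf (osup (u C)) \<in> elems \<chi>)"
| "chi_interp (RightChi R \<chi>) = (\<lambda>C D. sq_interp R C D \<or>
     (otp (u D) \<in> elems \<chi> \<and> (\<forall>\<beta>\<in>nacc (u D). \<exists>\<gamma>. Ord \<gamma> \<and> \<beta> = osucc \<gamma>)))"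

primrec rel_interp :: "'k hset rel_name \<Rightarrow> 'x \<Rightarrow> 'x \<Rightarrow> bool" where
  "rel_interp (Simple R) = chi_interp R"
| "rel_interp (Avoid \<Omega> R) = (\<lambda>C D. chi_interp R C D \<and> osup (u C) \<notin> \<Omega>)"

end

definition relK :: "'k hset rel_name \<Rightarrow> 'k hset set \<Rightarrow> 'k hset set \<Rightarrow> bool" where
  "relK = rel_interp sqK sqK_star (\<lambda>C. C)"

definition relF :: "'k hset rel_name \<Rightarrow> ('k hset \<rightharpoonup> 'k hset) \<Rightarrow> ('k hset \<rightharpoonup> 'k hset) \<Rightarrow> bool" where
  "relF = rel_interp sqF sqF_star dom"


section \<open>The proxy principles\<close>

definition P_minus ::
  "'k hset \<Rightarrow> 'k hset \<Rightarrow> 'k hset \<Rightarrow> 'k hset rel_name \<Rightarrow> 'k hset \<Rightarrow> 'k hset set set \<Rightarrow> 'k hset \<Rightarrow> bool"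
where
  "P_minus \<xi> \<kappa> \<mu> R \<theta> \<S> \<nu> \<longleftrightarrow> (\<exists>\<C> :: 'k hset \<Rightarrow> 'k hset set set.
     (\<forall>\<alpha>\<in>acc (elems \<kappa>).
        \<C> \<alpha> \<subseteq> {C \<in> KK \<kappa>. ole (otp C) \<xi> \<and> osup C = \<alpha>} \<and>
        \<C> \<alpha> \<noteq> {} \<and> |\<C> \<alpha>| <o |elems \<mu>| \<and>
        (\<forall>C\<in>\<C> \<alpha>. \<forall>\<alpha>'\<in>acc C. \<exists>D\<in>\<C> \<alpha>'. relK R D C)) \<and>
     (\<forall>B. (\<forall>i\<in>elems \<theta>. cofinal_in \<kappa> (B i)) \<longrightarrow>
        (\<forall>S\<in>\<S>. \<forall>n. stationary_in \<kappa> {\<alpha>\<in>S. |\<C> \<alpha>| <o |elems \<nu>| \<and>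
           (\<forall>C\<in>\<C> \<alpha>. \<forall>i\<in>elems \<alpha> \<inter> elems \<theta>.
              osup {\<gamma>\<in>C. succ_n n (C - elems \<gamma>) \<subseteq> B i} = \<alpha>)})))"

text \<open>\<open>B_hit \<kappa> B \<Omega> p C\<close> is the set written \<open>B(\<Omega>, p, C)\<close>.\<close>

definition B_hit ::
  "'k hset \<Rightarrow> 'k hset set \<Rightarrow> 'k hset set \<Rightarrow> 'k hset \<Rightarrow> ('k hset \<rightharpoonup> 'k hset) \<Rightarrow> 'k hset set"
where
  "B_hit \<kappa> B \<Omega> p C = {\<beta> \<in> B \<inter> dom C.
     \<exists>M. M \<prec> Hplus \<kappa> \<and> p \<in> M \<and> M \<inter> elems \<kappa> = elems \<beta> \<and> M \<inter> \<Omega> = elems (the (C \<beta>))}"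

definition P_bullet_witness ::
  "('k hset \<Rightarrow> ('k hset \<rightharpoonup> 'k hset) set) \<Rightarrow> ('k hset \<Rightarrow> 'k hset set) \<Rightarrow>
   'k hset \<Rightarrow> 'k hset \<Rightarrow> 'k hset \<Rightarrow> 'k hset rel_name \<Rightarrow> 'k hset \<Rightarrow> 'k hset set set \<Rightarrow> 'k hset \<Rightarrow> bool"
where
  "P_bullet_witness \<C> B \<xi> \<kappa> \<mu> R \<theta> \<S> \<nu> \<longleftrightarrow>
     is_partition \<kappa> B \<and>
     (\<forall>\<alpha>\<in>acc (elems \<kappa>).
        \<C> \<alpha> \<subseteq> {C \<in> FF \<kappa>. ole (otp (dom C)) \<xi> \<and> osup (dom C) = \<alpha>} \<and>
        \<C> \<alpha> \<noteq> {} \<and> |\<C> \<alpha>| <o |elems \<mu>| \<and>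
        (\<forall>C\<in>\<C> \<alpha>. \<forall>\<alpha>'\<in>acc (dom C). \<exists>D\<in>\<C> \<alpha>'. relF R D C)) \<and>
     (\<forall>\<Omega> p \<iota>. (\<forall>i\<in>elems \<theta>. \<Omega> i \<subseteq> H \<kappa> \<and> p i \<in> Hplus \<kappa> \<and> \<iota> i \<in> elems \<kappa>) \<longrightarrow>
        (\<forall>S\<in>\<S>. \<forall>n. stationary_in \<kappa> {\<alpha>\<in>S. |\<C> \<alpha>| <o |elems \<nu>| \<and>
           (\<forall>C\<in>\<C> \<alpha>. \<forall>i\<in>elems \<alpha> \<inter> elems \<theta>.
              osup {\<gamma>\<in>dom C. succ_n n (dom C - elems \<gamma>) \<subseteq> B_hit \<kappa> (B (\<iota> i)) (\<Omega> i) (p i) C} = \<alpha>)}))"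

end

theory Submission
  imports Defs
begin

text \<open>
  Since \<open>\<kappa>\<close> to the power \<open><\<kappa>\<close> is \<open>\<kappa>\<close>, limit ordinals \<open>\<delta> < \<kappa>\<close> can code all pairs \<open>(bt \<delta>, xv \<delta>)\<close> of an ordinal
  below \<open>\<kappa>\<close> and a member of \<open>H \<kappa>\<close>, in such a way that every pair has a code \<open>\<delta> \<ge> bt \<delta>\<close>. A club \<open>C\<close> is turned
  into a function by moving each \<open>\<delta> \<in> nacc C\<close> with \<open>sup (C \<inter> \<delta>) < bt \<delta> \<le> \<delta>\<close> down to \<open>bt \<delta>\<close>, with value
  \<open>xv \<delta>\<close>; all other points stay, with value \<open>\<emptyset>\<close>. The move at \<open>\<delta>\<close> depends only on \<open>sup (C \<inter> \<delta>)\<close>, so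
  coherence is preserved.

  Given \<open>(\<Omega>, p, \<iota>)\<close>, the Skolem hulls \<open>M\<close> of \<open>\<beta> \<union> {p}\<close> satisfy \<open>M \<inter> \<kappa> = \<beta>\<close> for club many \<open>\<beta>\<close>, hence for
  stationarily many \<open>\<beta> \<in> B \<iota>\<close>, and \<open>M \<inter> \<Omega>\<close> is a member of \<open>H \<kappa>\<close> as \<open>M\<close> is small. The codes of the pairs
  \<open>(\<beta>, M \<inter> \<Omega>)\<close>, thinned out so that each code lies below all later \<open>\<beta>\<close>, form a cofinal set. If the
  first \<open>n + 1\<close> successors of \<open>\<gamma>\<close> in \<open>C\<close> belong to it, then all but the first of them get moved.
\<close>

section \<open>Ordinals\<close>

lemma mem_asym: "x \<in> elems y \<Longrightarrow> y \<notin> elems (x :: 'k hset)"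
  using wf_not_sym[OF wf_mem, of x y] by (auto simp: mem_def)

lemma mem_irrefl: "x \<notin> elems (x :: 'k hset)"
  using mem_asym by blast

lemma hset_induct: "(\<And>x :: 'k hset. (\<And>y. y \<in> elems x \<Longrightarrow> P y) \<Longrightarrow> P x) \<Longrightarrow> P x"
  using wf_induct_rule[OF wf_mem, of P x] by (auto simp: mem_def)

lemma card_elems: "|elems (x :: 'k hset)| \<le>o |UNIV :: 'k set|"
  using ex_elems_iff by blast

text \<open>\<open>hset_of\<close> is a definite description; the size bound is what makes it
  denote, with \<open>ex_elems_iff\<close> supplying the set and \<open>elems_inject\<close> its
  uniqueness.\<close>

lemma elems_hset_of: "|X| \<le>o |UNIV :: 'k set| \<Longrightarrow> elems (hset_of X :: 'k hset) = X"
  unfolding hset_of_def using ex_elems_iff[of X] elems_inject by (metis (mono_tags, lifting) the_equality)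

lemma elems_hset_of_subset: "X \<subseteq> elems (y :: 'k hset) \<Longrightarrow> elems (hset_of X) = X"
  by (meson card_elems card_of_mono1 elems_hset_of ordLeq_transitive)

lemma elems_ozero: "elems (ozero :: 'k hset) = {}"
  unfolding ozero_def by (rule elems_hset_of) (rule card_of_empty)

lemma Ord_elem: "Ord x \<Longrightarrow> y \<in> elems x \<Longrightarrow> Ord y"
  unfolding Ord_def by blast

lemma Ord_subset: "Ord x \<Longrightarrow> y \<in> elems x \<Longrightarrow> elems y \<subseteq> elems x"
  unfolding Ord_def by blast

text \<open>Nested induction on both ordinals. If they were incomparable, the induction hypotheses
  would place each element of either one in the other, and extensionality would make them
  equal.\<close>

lemma Ord_linear: "Ord a \<Longrightarrow> Ord b \<Longrightarrow> a \<in> elems b \<or> a = b \<or> b \<in> elems a"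
proof (induction a arbitrary: b rule: hset_induct)
  case (1 a)
  note IHa = 1
  show ?case
    using IHa(3)
  proof (induction b rule: hset_induct)
    case (1 b)
    show ?case
    proof (rule ccontr)
      assume neg: "\<not> ?thesis"
      have "elems a \<subseteq> elems b"
      proof
        fix x assume x: "x \<in> elems a"
        then have "x \<in> elems b \<or> x = b \<or> b \<in> elems x"
          using IHa(1)[OF x] Ord_elem[OF IHa(2) x] 1(2) by blast
        then show "x \<in> elems b" using neg x Ord_subset[OF IHa(2) x] by blast
      qed
      moreover have "elems b \<subseteq> elems a"
      proof
        fix y assume y: "y \<in> elems b"
        then have "a \<in> elems y \<or> a = y \<or> y \<in> elems a"
          using 1(1)[OF y] Ord_elem[OF 1(2) y] by blast
        then show "y \<in> elems a" using neg y Ord_subset[OF 1(2) y] by blast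
      qed
      ultimately show False using neg elems_inject[of a b] by blast
    qed
  qed
qed

lemma ole_iff_subset: "Ord a \<Longrightarrow> Ord b \<Longrightarrow> ole a b \<longleftrightarrow> elems a \<subseteq> elems b"
  unfolding ole_def using Ord_linear[of a b] Ord_subset[of b a] mem_irrefl[of b] by blast

lemma Ord_osup:
  assumes "\<And>a. a \<in> A \<Longrightarrow> Ord a" and "|\<Union>a\<in>A. elems a| \<le>o |UNIV :: 'k set|"
  shows "Ord (osup A :: 'k hset)"
proof -
  have e: "elems (osup A) = (\<Union>a\<in>A. elems a)"
    unfolding osup_def using assms(2) by (rule elems_hset_of)
  show ?thesis
    unfolding Ord_def e using assms(1) unfolding Ord_def by blast
qed

section \<open>Order types\<close>

text \<open>The condition inside the description \<open>otp\<close>, with the isomorphism named so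
  that it can be reasoned about.\<close>

definition otp_iso :: "'k hset set \<Rightarrow> 'k hset \<Rightarrow> ('k hset \<Rightarrow> 'k hset) \<Rightarrow> bool" where
  "otp_iso A \<alpha> f \<longleftrightarrow> Ord \<alpha> \<and> bij_betw f A (elems \<alpha>) \<and>
     (\<forall>x\<in>A. \<forall>y\<in>A. x \<in> elems y \<longleftrightarrow> f x \<in> elems (f y))"

text \<open>\<open>elems \<alpha>\<close> is transitive and is the range of \<open>f\<close>, so
  every element of \<open>f x\<close> is itself a value of \<open>f\<close>. This recursion equation
  identifies \<open>f\<close> as the Mostowski collapse of \<open>A\<close>.\<close>

lemma otp_iso_elems:
  assumes "otp_iso A \<alpha> f" "x \<in> A"
  shows "elems (f x) = f ` (A \<inter> elems x)"
proof
  have O: "Ord \<alpha>" and b: "f ` A = elems \<alpha>"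
    and m: "\<And>x y. x \<in> A \<Longrightarrow> y \<in> A \<Longrightarrow> x \<in> elems y \<longleftrightarrow> f x \<in> elems (f y)"
    using assms(1) by (auto simp: otp_iso_def bij_betw_def)
  show "f ` (A \<inter> elems x) \<subseteq> elems (f x)"
    using m assms(2) by blast
  have "elems (f x) \<subseteq> f ` A"
    using b O assms(2) Ord_subset by blast
  then show "elems (f x) \<subseteq> f ` (A \<inter> elems x)"
    using m assms(2) by blast
qed

text \<open>The recursion equation determines the collapse by induction on membership, and the
  ordinal is its range.\<close>

lemma otp_iso_unique:
  assumes "otp_iso A \<alpha> f" "otp_iso A \<beta> g"
  shows "\<alpha> = \<beta>"
proof -
  have "x \<in> A \<longrightarrow> f x = g x" for x
  proof (induction x rule: hset_induct)
    case (1 x)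
    show ?case
    proof
      assume x: "x \<in> A"
      have "f ` (A \<inter> elems x) = g ` (A \<inter> elems x)"
        using 1 by (intro image_cong) auto
      then show "f x = g x"
        using otp_iso_elems[OF assms(1) x] otp_iso_elems[OF assms(2) x] elems_inject by metis
    qed
  qed
  then have "f ` A = g ` A" by (intro image_cong) auto
  then show ?thesis
    using assms elems_inject unfolding otp_iso_def bij_betw_def by metis
qed

lemma otp_eqI: "otp_iso A \<alpha> f \<Longrightarrow> otp A = \<alpha>"
proof -
  assume a: "otp_iso A \<alpha> f"
  have "otp A = (THE \<alpha>. \<exists>f. otp_iso A \<alpha> f)"
    unfolding otp_def otp_iso_def by (rule arg_cong[of _ _ The]) auto
  also have "\<dots> = \<alpha>"
    using a otp_iso_unique by blast
  finally show ?thesis .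
qed

text \<open>The isomorphism is the Mostowski collapse of \<open>A\<close>; the bound on the size of
  \<open>A\<close> makes each image taken in the recursion a set of the universe.\<close>

lemma otp_iso_exists:
  fixes A :: "'k hset set"
  assumes O: "\<And>a. a \<in> A \<Longrightarrow> Ord a" and card: "|A| \<le>o |UNIV :: 'k set|"
  shows "\<exists>f. otp_iso A (otp A) f"
proof -
  define col :: "'k hset \<Rightarrow> 'k hset" where "col = wfrec mem (\<lambda>g x. hset_of (g ` (A \<inter> elems x)))"
  have col: "col x = hset_of (col ` (A \<inter> elems x))" for x
  proof -
    have "col x = hset_of (cut col mem x ` (A \<inter> elems x))"
      unfolding col_def by (subst wfrec[OF wf_mem]) simp
    also have "cut col mem x ` (A \<inter> elems x) = col ` (A \<inter> elems x)"
      by (intro image_cong) (auto simp: cut_def mem_def)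
    finally show ?thesis .
  qed
  have le: "|col ` X| \<le>o |UNIV :: 'k set|" if "X \<subseteq> A" for X
    by (meson card card_of_image card_of_mono1 ordLeq_transitive that)
  have ec: "elems (col x) = col ` (A \<inter> elems x)" for x
    using elems_hset_of[OF le[of "A \<inter> elems x"]] col[of x] by simp
  define \<alpha> where "\<alpha> = hset_of (col ` A)"
  have ea: "elems \<alpha> = col ` A"
    unfolding \<alpha>_def by (rule elems_hset_of) (rule le, blast)
  have "Ord \<alpha>"
    unfolding Ord_def ea
  proof (intro conjI ballI)
    fix y assume "y \<in> col ` A"
    then obtain x where x: "x \<in> A" "y = col x" by blast
    then show "elems y \<subseteq> col ` A" using ec by auto
    fix z assume "z \<in> elems y"
    then obtain w where w: "w \<in> A" "w \<in> elems x" "z = col w" using ec x by auto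
    have "elems w \<subseteq> elems x" using Ord_subset[OF O[OF x(1)] w(2)] .
    then show "elems z \<subseteq> elems y" using ec x w by auto
  qed
  moreover have m: "x \<in> elems y \<longleftrightarrow> col x \<in> elems (col y)" if xy: "x \<in> A" "y \<in> A" for x y
  proof
    assume "x \<in> elems y" then show "col x \<in> elems (col y)" using xy ec by auto
  next
    assume c: "col x \<in> elems (col y)"
    consider "x \<in> elems y" | "x = y" | "y \<in> elems x" using Ord_linear[OF O O] xy by blast
    then show "x \<in> elems y"
    proof cases
      case 3
      then have "col y \<in> elems (col x)" using xy ec by auto
      then show ?thesis using c mem_asym by blast
    qed (use c mem_irrefl in auto)
  qed
  moreover have "inj_on col A"
  proof (rule inj_onI)
    fix x y assume "x \<in> A" "y \<in> A" "col x = col y"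
    then show "x = y" using m[of x y] m[of y x] Ord_linear[OF O O, of x y] mem_irrefl by metis
  qed
  ultimately have "otp_iso A \<alpha> col"
    unfolding otp_iso_def bij_betw_def using ea by blast
  then show ?thesis using otp_eqI by blast
qed

lemma otp_iso_restrict:
  assumes "otp_iso A \<alpha> f" "x \<in> A"
  shows "otp_iso (A \<inter> elems x) (f x) f"
proof -
  have "Ord (f x)"
    using assms Ord_elem[of \<alpha> "f x"] by (auto simp: otp_iso_def bij_betw_def)
  then show ?thesis
    using assms otp_iso_elems[OF assms] unfolding otp_iso_def bij_betw_def inj_on_def by auto
qed

text \<open>By \<open>otp_iso_restrict\<close> the collapse sends each \<open>x\<close> to the order
  type of the segment of \<open>A\<close> below it.\<close>

lemma elems_otp:
  fixes A :: "'k hset set"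
  assumes "\<And>a. a \<in> A \<Longrightarrow> Ord a" and "|A| \<le>o |UNIV :: 'k set|"
  shows "elems (otp A) = (\<lambda>x. otp (A \<inter> elems x)) ` A"
proof -
  obtain f where f: "otp_iso A (otp A) f" using otp_iso_exists[OF assms] by blast
  have "elems (otp A) = f ` A" using f by (auto simp: otp_iso_def bij_betw_def)
  also have "\<dots> = (\<lambda>x. otp (A \<inter> elems x)) ` A"
    using otp_eqI[OF otp_iso_restrict[OF f]] by (intro image_cong) auto
  finally show ?thesis .
qed

lemma otp_image:
  fixes A :: "'k hset set"
  assumes "\<And>a. a \<in> A \<Longrightarrow> Ord a" and "|A| \<le>o |UNIV :: 'k set|"
    and inj: "inj_on g A" and m: "\<And>x y. x \<in> A \<Longrightarrow> y \<in> A \<Longrightarrow> g x \<in> elems (g y) \<longleftrightarrow> x \<in> elems y"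
  shows "otp (g ` A) = otp A"
proof -
  obtain f where f: "otp_iso A (otp A) f" using otp_iso_exists[OF assms(1,2)] by blast
  have "bij_betw (f \<circ> inv_into A g) (g ` A) (elems (otp A))"
    using f inj unfolding otp_iso_def
    by (meson bij_betw_imageI bij_betw_inv_into bij_betw_trans)
  then have "otp_iso (g ` A) (otp A) (f \<circ> inv_into A g)"
    using f inj m unfolding otp_iso_def by auto
  then show ?thesis by (rule otp_eqI)
qed

section \<open>Regular cardinals\<close>

lemma ozero_mem_Ord: "Ord a \<Longrightarrow> x \<in> elems a \<Longrightarrow> ozero \<in> elems a"
  using Ord_linear[of ozero a] elems_ozero unfolding Ord_def by blast

locale regular_cardinal =
  fixes \<kappa> :: "'k hset"
  assumes regular: "regular_uncountable \<kappa>"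
begin

abbreviation small :: "'a set \<Rightarrow> bool" where
  "small X \<equiv> |X| <o |elems \<kappa>|"

lemma Cardinal_\<kappa>: "Cardinal \<kappa>"
  using regular by (simp add: regular_uncountable_def)

lemma Ord_\<kappa>: "Ord \<kappa>"
  using Cardinal_\<kappa> by (simp add: Cardinal_def)

lemma uncountable_\<kappa>: "uncountable (elems \<kappa>)"
  using regular by (simp add: regular_uncountable_def)

lemma infinite_\<kappa>: "infinite (elems \<kappa>)"
  using uncountable_\<kappa> countable_finite by blast

lemma infinite_UNIV_k: "infinite (UNIV :: 'k set)"
  by (rule card_of_ordLeq_infinite[OF card_elems infinite_\<kappa>])

lemma Ord_below: "a \<in> elems \<kappa> \<Longrightarrow> Ord a"
  using Ord_\<kappa> Ord_elem by blast

lemma below_subset: "a \<in> elems \<kappa> \<Longrightarrow> elems a \<subseteq> elems \<kappa>"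
  using Ord_\<kappa> Ord_subset by blast

lemma below_trans: "c \<in> elems \<kappa> \<Longrightarrow> a \<in> elems b \<Longrightarrow> b \<in> elems c \<Longrightarrow> a \<in> elems c"
  using Ord_below Ord_subset by blast

lemma below_linear: "a \<in> elems \<kappa> \<Longrightarrow> b \<in> elems \<kappa> \<Longrightarrow> a \<in> elems b \<or> a = b \<or> b \<in> elems a"
  using Ord_below Ord_linear by blast

lemma ole_below_iff: "a \<in> elems \<kappa> \<Longrightarrow> b \<in> elems \<kappa> \<Longrightarrow> ole a b \<longleftrightarrow> elems a \<subseteq> elems b"
  using ole_iff_subset Ord_below by blast

lemma small_subset: "X \<subseteq> Y \<Longrightarrow> small Y \<Longrightarrow> small X"
  by (meson card_of_mono1 ordLeq_ordLess_trans)

lemma small_image: "small X \<Longrightarrow> small (f ` X)"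
  by (meson card_of_image ordLeq_ordLess_trans)

lemma small_below: "b \<in> elems \<kappa> \<Longrightarrow> X \<subseteq> elems b \<Longrightarrow> small X"
  using Cardinal_\<kappa> small_subset unfolding Cardinal_def by blast

lemma card_subset_\<kappa>: "X \<subseteq> elems \<kappa> \<Longrightarrow> |X| \<le>o |UNIV :: 'k set|"
  by (meson card_elems card_of_mono1 ordLeq_transitive)

lemma otp_iso_below: "X \<subseteq> elems \<kappa> \<Longrightarrow> \<exists>f. otp_iso X (otp X) f"
  by (rule otp_iso_exists) (auto intro: Ord_below card_subset_\<kappa>)

lemma Ord_otp: "X \<subseteq> elems \<kappa> \<Longrightarrow> Ord (otp X)"
  using otp_iso_below[of X] unfolding otp_iso_def by blast

lemma card_otp: "X \<subseteq> elems \<kappa> \<Longrightarrow> |X| =o |elems (otp X)|"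
  by (metis otp_iso_below otp_iso_def card_of_ordIsoI)

text \<open>The minimality clause in the definite description \<open>cf\<close> yields that no cofinal subset
  of \<open>\<kappa>\<close> is small.\<close>

lemma ole_\<kappa>_otp_cofinal:
  assumes "A \<subseteq> elems \<kappa>" "\<forall>\<beta>\<in>elems \<kappa>. \<exists>a\<in>A. ole \<beta> a"
  shows "ole \<kappa> (otp A)"
proof -
  define cof where "cof A \<longleftrightarrow> A \<subseteq> elems \<kappa> \<and> (\<forall>\<beta>\<in>elems \<kappa>. \<exists>a\<in>A. ole \<beta> a)" for A
  define P where "P \<rho> \<longleftrightarrow> (\<exists>A. cof A \<and> otp A = \<rho>) \<and> (\<forall>A. cof A \<longrightarrow> ole \<rho> (otp A))" for \<rho>
  have cf: "cf \<kappa> = The P"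
    unfolding cf_def P_def cof_def by (rule arg_cong[of _ _ The]) (auto simp: fun_eq_iff)
  \<comment> \<open>Regularity is an equation about \<open>The P\<close>. To extract the minimality
    clause from it, some ordinal must satisfy \<open>P\<close>, namely the least order type of a
    cofinal set, and it must be the only one.\<close>
  have "cof (elems \<kappa>)" by (auto simp: cof_def ole_def)
  then have "otp (elems \<kappa>) \<in> otp ` Collect cof" by blast
  then obtain \<rho> where \<rho>: "\<rho> \<in> otp ` Collect cof" "\<And>y. (y, \<rho>) \<in> mem \<Longrightarrow> y \<notin> otp ` Collect cof"
    using wfE_min[OF wf_mem] by metis
  obtain A0 where A0: "cof A0" "\<rho> = otp A0" using \<rho>(1) by blast
  have "ole \<rho> (otp A)" if "cof A" for A
  proof -
    have "otp A \<notin> elems \<rho>" using \<rho>(2)[of "otp A"] that by (auto simp: mem_def)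
    moreover have "Ord (otp A)" "Ord \<rho>" using that A0 Ord_otp by (auto simp: cof_def)
    ultimately show ?thesis using Ord_linear unfolding ole_def by blast
  qed
  then have P: "P \<rho>" using A0 by (auto simp: P_def)
  have un: "\<rho>' = \<rho>''" if "P \<rho>'" "P \<rho>''" for \<rho>' \<rho>''
  proof -
    have "ole \<rho>' \<rho>''" "ole \<rho>'' \<rho>'" using that unfolding P_def by blast+
    then show ?thesis using mem_asym[of \<rho>' \<rho>''] unfolding ole_def by blast
  qed
  have "P (The P)" using P un[OF _ P] by (rule theI)
  moreover have "The P = \<kappa>" using cf regular by (simp add: regular_uncountable_def)
  ultimately have "\<forall>A. cof A \<longrightarrow> ole \<kappa> (otp A)" unfolding P_def by simp
  then show ?thesis using assms by (auto simp: cof_def)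
qed

text \<open>An unbounded set is cofinal, so its order type is at least \<kappa> and its cardinality
  at least that of \<kappa>.\<close>

lemma small_bounded:
  assumes "X \<subseteq> elems \<kappa>" "small X"
  shows "\<exists>b\<in>elems \<kappa>. X \<subseteq> elems b"
proof (rule ccontr)
  assume neg: "\<not> ?thesis"
  have "\<exists>a\<in>X. ole \<beta> a" if b: "\<beta> \<in> elems \<kappa>" for \<beta>
  proof -
    obtain a where "a \<in> X" "a \<notin> elems \<beta>" using neg b by blast
    then show ?thesis using below_linear[of a \<beta>] b assms(1) unfolding ole_def by blast
  qed
  then have "ole \<kappa> (otp X)" using ole_\<kappa>_otp_cofinal assms(1) by blast
  then have "elems \<kappa> \<subseteq> elems (otp X)"
    using ole_iff_subset[OF Ord_\<kappa> Ord_otp[OF assms(1)]] by blast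
  then have "|elems \<kappa>| \<le>o |elems (otp X)|" by (rule card_of_mono1)
  then have "|elems \<kappa>| \<le>o |X|"
    using card_otp[OF assms(1)] ordIso_symmetric ordLeq_ordIso_trans by blast
  then show False using assms(2) not_ordLess_ordLeq by blast
qed

section \<open>Arithmetic of small sets\<close>

lemma not_small_iff: "\<not> small X \<longleftrightarrow> |elems \<kappa>| \<le>o |X|"
  by (rule not_ordLess_iff_ordLeq[OF card_of_Well_order card_of_Well_order])

lemma small_countable: "countable X \<Longrightarrow> small X"
proof (rule ccontr)
  assume c: "countable X" and "\<not> small X"
  then have "|elems \<kappa>| \<le>o |X|" by (simp only: not_small_iff)
  then obtain f where "inj_on f (elems \<kappa>)" "f ` elems \<kappa> \<subseteq> X" using card_of_ordLeq by metis
  then show False using c uncountable_\<kappa> countable_image_inj_on countable_subset by metis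
qed

text \<open>Otherwise \<kappa> injects into the union. The preimage of each \<open>A i\<close> is
  small, hence bounded; these bounds are few, hence bounded too, which would bound \<kappa> below
  itself.\<close>

lemma small_UN:
  assumes "small I" "\<And>i. i \<in> I \<Longrightarrow> small (A i)"
  shows "small (\<Union>i\<in>I. A i)"
proof (rule ccontr)
  assume "\<not> ?thesis"
  then have "|elems \<kappa>| \<le>o |\<Union>i\<in>I. A i|" by (simp only: not_small_iff)
  then obtain f where f: "inj_on f (elems \<kappa>)" "f ` elems \<kappa> \<subseteq> (\<Union>i\<in>I. A i)"
    using card_of_ordLeq by metis
  have "\<exists>b\<in>elems \<kappa>. {x \<in> elems \<kappa>. f x \<in> A i} \<subseteq> elems b" if i: "i \<in> I" for i
  proof (rule small_bounded)
    have "inj_on f {x \<in> elems \<kappa>. f x \<in> A i}" using f(1) by (auto simp: inj_on_def)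
    then have "|{x \<in> elems \<kappa>. f x \<in> A i}| \<le>o |A i|"
      by (intro card_of_ordLeqI[where f = f]) auto
    then show "small {x \<in> elems \<kappa>. f x \<in> A i}" using assms(2)[OF i] ordLeq_ordLess_trans by blast
  qed auto
  then have "\<forall>i\<in>I. \<exists>b. b \<in> elems \<kappa> \<and> {x \<in> elems \<kappa>. f x \<in> A i} \<subseteq> elems b" by blast
  from bchoice[OF this] obtain b
    where b: "\<forall>i\<in>I. b i \<in> elems \<kappa> \<and> {x \<in> elems \<kappa>. f x \<in> A i} \<subseteq> elems (b i)" ..
  have "b ` I \<subseteq> elems \<kappa>" using b by blast
  then obtain c where c: "c \<in> elems \<kappa>" "b ` I \<subseteq> elems c"
    using small_bounded[of "b ` I"] small_image[OF assms(1)] by blast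
  have "elems \<kappa> \<subseteq> elems c"
  proof
    fix x assume x: "x \<in> elems \<kappa>"
    then obtain i where "i \<in> I" "f x \<in> A i" using f(2) by blast
    then have "x \<in> elems (b i)" "b i \<in> elems c" using b c x by blast+
    then show "x \<in> elems c" using below_trans c(1) by blast
  qed
  then show False using c(1) mem_irrefl by blast
qed

lemma small_Un: "small X \<Longrightarrow> small Y \<Longrightarrow> small (X \<union> Y)"
  by (rule card_of_Un_ordLess_infinite[OF infinite_\<kappa>])

lemma small_finite: "finite X \<Longrightarrow> small X"
  by (rule small_countable[OF countable_finite])

text \<open>The lists are a countable union over their lengths. Parameters of Skolem functions come
  as such lists.\<close>

lemma small_lists: "small X \<Longrightarrow> small (lists X)"
proof -
  assume X: "small X"
  have n: "small {l. set l \<subseteq> X \<and> length l = n}" for n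
  proof (induction n)
    case 0
    then show ?case by (intro small_finite) auto
  next
    case (Suc n)
    have "{l. set l \<subseteq> X \<and> length l = Suc n} \<subseteq> (\<Union>x\<in>X. (#) x ` {l. set l \<subseteq> X \<and> length l = n})"
      by (auto simp: length_Suc_conv)
    moreover have "small (\<Union>x\<in>X. (#) x ` {l. set l \<subseteq> X \<and> length l = n})"
      using X small_image[OF Suc] by (rule small_UN)
    ultimately show ?case by (rule small_subset)
  qed
  have "lists X \<subseteq> (\<Union>n\<in>(UNIV :: nat set). {l. set l \<subseteq> X \<and> length l = n})"
    by auto
  moreover have "small (\<Union>n\<in>(UNIV :: nat set). {l. set l \<subseteq> X \<and> length l = n})"
    by (rule small_UN) (auto intro: small_countable n)
  ultimately show ?thesis by (rule small_subset)
qed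

section \<open>Suprema and closed unbounded sets\<close>

lemma elems_osup: "A \<subseteq> elems \<kappa> \<Longrightarrow> elems (osup A) = (\<Union>a\<in>A. elems a)"
  unfolding osup_def using below_subset by (intro elems_hset_of_subset[of _ \<kappa>]) blast

lemma osup_eq_iff: "A \<subseteq> elems \<kappa> \<Longrightarrow> osup A = a \<longleftrightarrow> (\<Union>a\<in>A. elems a) = elems a"
  using elems_osup[of A] elems_inject[of "osup A" a] by simp

lemma osup_Int_below:
  assumes "A \<subseteq> elems \<kappa>" "b \<in> elems \<kappa>"
  shows "osup (A \<inter> elems b) \<in> elems \<kappa>" "elems (osup (A \<inter> elems b)) \<subseteq> elems b"
proof -
  have sub: "A \<inter> elems b \<subseteq> elems \<kappa>" using assms by blast
  show le: "elems (osup (A \<inter> elems b)) \<subseteq> elems b"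
    unfolding elems_osup[OF sub] using assms Ord_below Ord_subset by blast
  have "Ord (osup (A \<inter> elems b))"
    using sub Ord_below below_subset by (intro Ord_osup card_subset_\<kappa>) blast+
  then have "osup (A \<inter> elems b) \<in> elems b \<or> osup (A \<inter> elems b) = b"
    using ole_iff_subset[of _ b] Ord_below[OF assms(2)] le unfolding ole_def by blast
  then show "osup (A \<inter> elems b) \<in> elems \<kappa>" using assms(2) below_subset[OF assms(2)] by auto
qed

lemma exists_above: "a \<in> elems \<kappa> \<Longrightarrow> \<exists>b\<in>elems \<kappa>. a \<in> elems b"
  using small_bounded[of "{a}"] small_finite[of "{a}"] by auto

lemma cofinal_in_\<kappa>_iff:
  "cofinal_in \<kappa> A \<longleftrightarrow> A \<subseteq> elems \<kappa> \<and> (\<forall>e\<in>elems \<kappa>. \<exists>a\<in>A. e \<in> elems a)"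
proof (cases "A \<subseteq> elems \<kappa>")
  case True
  then have "osup A = \<kappa> \<longleftrightarrow> (\<Union>a\<in>A. elems a) = elems \<kappa>" by (rule osup_eq_iff)
  moreover have "(\<Union>a\<in>A. elems a) \<subseteq> elems \<kappa>" using True below_subset by blast
  ultimately show ?thesis using True unfolding cofinal_in_def by auto
qed (simp add: cofinal_in_def)

text \<open>Iterating a bound for the values of \<open>F\<close> gives a countable sequence, bounded
  below \<kappa> by regularity, whose supremum is a closure point. At a limit \<open>\<beta>\<close>
  of closure points each \<open>\<gamma>\<close> below \<open>\<beta>\<close> lies below one of
  them, which already contains \<open>F \<gamma>\<close>.\<close>

lemma club_closure_points:
  assumes F: "\<And>\<gamma>. \<gamma> \<in> elems \<kappa> \<Longrightarrow> F \<gamma> \<subseteq> elems \<kappa> \<and> small (F \<gamma>)"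
  shows "club_in \<kappa> {\<beta> \<in> elems \<kappa>. ozero \<in> elems \<beta> \<and> (\<forall>\<gamma>\<in>elems \<beta>. F \<gamma> \<subseteq> elems \<beta>)}"
    (is "club_in \<kappa> ?E")
proof -
  have "\<exists>\<beta>\<in>?E. e \<in> elems \<beta>" if e: "e \<in> elems \<kappa>" for e
  proof -
    obtain z where z: "z \<in> elems \<kappa>" "e \<in> elems z" using exists_above[OF e] by blast
    then have z0: "ozero \<in> elems z" using ozero_mem_Ord[OF Ord_below] by blast
    \<comment> \<open>\<open>e\<close> and \<open>z\<close> are thrown in at every stage so that the
      supremum lies above \<open>e\<close> and contains \<open>ozero\<close>.\<close>
    have "\<exists>c\<in>elems \<kappa>. elems b \<union> (\<Union>\<gamma>\<in>elems b. F \<gamma>) \<union> {b, e, z} \<subseteq> elems c" if b: "b \<in> elems \<kappa>" for b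
    proof (rule small_bounded)
      show "elems b \<union> (\<Union>\<gamma>\<in>elems b. F \<gamma>) \<union> {b, e, z} \<subseteq> elems \<kappa>"
        using b e z F below_subset by blast
      show "small (elems b \<union> (\<Union>\<gamma>\<in>elems b. F \<gamma>) \<union> {b, e, z})"
      proof (intro small_Un)
        show "small (\<Union>\<gamma>\<in>elems b. F \<gamma>)"
          by (rule small_UN) (use F below_subset[OF b] small_below[OF b order_refl] in blast)+
      qed (rule small_below[OF b order_refl], rule small_finite, simp)
    qed
    then obtain g where g: "\<And>b. b \<in> elems \<kappa> \<Longrightarrow> g b \<in> elems \<kappa> \<and>
        elems b \<union> (\<Union>\<gamma>\<in>elems b. F \<gamma>) \<union> {b, e, z} \<subseteq> elems (g b)"
      by (metis (no_types, lifting))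
    define s where "s n = (g ^^ n) e" for n
    have s0: "s 0 = e" and sS: "s (Suc n) = g (s n)" for n by (simp_all add: s_def)
    have s: "s n \<in> elems \<kappa>" for n by (induction n) (auto simp: s0 sS e g)
    obtain c where c: "c \<in> elems \<kappa>" "range s \<subseteq> elems c"
      using small_bounded[of "range s"] s small_countable[of "range s"] by auto
    \<comment> \<open>The intersection leaves \<open>range s\<close> unchanged; it brings the
      supremum into the form treated by \<open>osup_Int_below\<close>.\<close>
    define \<beta> where "\<beta> = osup (range s \<inter> elems c)"
    have \<beta>: "\<beta> \<in> elems \<kappa>" unfolding \<beta>_def using osup_Int_below[of "range s" c] s c by blast
    have e\<beta>: "elems \<beta> = (\<Union>n. elems (s n))"
      unfolding \<beta>_def using elems_osup[of "range s"] s Int_absorb2[OF c(2)] by auto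
    have st: "elems (s n) \<union> (\<Union>\<gamma>\<in>elems (s n). F \<gamma>) \<union> {s n, e, z} \<subseteq> elems (s (Suc n))" for n
      unfolding sS using g[OF s] by blast
    have "ozero \<in> elems \<beta>"
      using st[of 0] z0 below_trans[OF s[of 1], of ozero z] unfolding e\<beta> by auto
    moreover have "e \<in> elems \<beta>" using st[of 0] unfolding e\<beta> by blast
    moreover have "F \<gamma> \<subseteq> elems \<beta>" if "\<gamma> \<in> elems \<beta>" for \<gamma>
      using that st unfolding e\<beta> by blast
    ultimately show ?thesis using \<beta> by blast
  qed
  then have "cofinal_in \<kappa> ?E" unfolding cofinal_in_\<kappa>_iff by blast
  moreover have "\<beta> \<in> ?E" if \<beta>: "\<beta> \<in> elems \<kappa>" "ozero \<in> elems \<beta>" "osup (?E \<inter> elems \<beta>) = \<beta>" for \<beta>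
  proof -
    have "(\<Union>a\<in>?E \<inter> elems \<beta>. elems a) = elems \<beta>"
      using \<beta>(3) osup_eq_iff[of "?E \<inter> elems \<beta>" \<beta>] by blast
    then have "F \<gamma> \<subseteq> elems \<beta>" if "\<gamma> \<in> elems \<beta>" for \<gamma>
      using that by blast
    then show ?thesis using \<beta> by blast
  qed
  ultimately show ?thesis unfolding club_in_def by blast
qed

section \<open>Finite order types\<close>

lemma elems_osucc: "elems (osucc a) = insert a (elems (a :: 'k hset))"
proof -
  have "|{a} \<union> elems a| \<le>o |UNIV :: 'k set|"
    using infinite_UNIV_k card_elems[of a] card_of_singl_ordLeq[of "UNIV :: 'k set" a]
    by (intro card_of_Un_ordLeq_infinite_Field) (auto simp: Field_card_of intro: card_of_card_order_on)
  then show ?thesis unfolding osucc_def by (intro elems_hset_of) simp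
qed

lemma finite_ord_of_nat:
  "finite (elems (ord_of_nat n :: 'k hset)) \<and> card (elems (ord_of_nat n :: 'k hset)) = n"
  by (induction n) (auto simp: ord_of_nat_def elems_ozero elems_osucc mem_irrefl)

lemma finite_has_max:
  assumes "finite A" "A \<noteq> {}" "A \<subseteq> elems \<kappa>"
  shows "\<exists>m\<in>A. A - {m} \<subseteq> elems m"
  using assms
proof (induction rule: finite_ne_induct)
  case (singleton x)
  then show ?case by auto
next
  case (insert x F)
  then obtain m where m: "m \<in> F" "F - {m} \<subseteq> elems m" by auto
  have "x \<in> elems m \<or> m \<in> elems x" using below_linear[of x m] insert m by auto
  then show ?case
  proof
    assume "x \<in> elems m"
    then show ?thesis using m by auto
  next
    assume mx: "m \<in> elems x"
    then have "elems m \<subseteq> elems x" using insert Ord_subset[OF Ord_below[of x]] by auto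
    then show ?thesis using m mx by auto
  qed
qed

lemma elems_otp_below: "A \<subseteq> elems \<kappa> \<Longrightarrow> elems (otp A) = (\<lambda>x. otp (A \<inter> elems x)) ` A"
  by (rule elems_otp) (auto intro: Ord_below card_subset_\<kappa>)

text \<open>Induction removing the maximum \<open>m\<close>: the segment below \<open>m\<close> has
  an order type that is one element of the new order type, and the remaining elements are those of
  that ordinal. This is the von Neumann successor.\<close>

lemma otp_finite: "finite A \<Longrightarrow> A \<subseteq> elems \<kappa> \<Longrightarrow> otp A = ord_of_nat (card A)"
proof (induction "card A" arbitrary: A)
  case 0
  then have "A = {}" by simp
  then have "elems (otp A) = {}" using elems_otp_below[of A] by simp
  then have "otp A = ozero" using elems_inject[of "otp A" ozero] by (simp add: elems_ozero)
  then show ?case using \<open>A = {}\<close> by (simp add: ord_of_nat_def)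
next
  case (Suc n)
  then have "A \<noteq> {}" by auto
  then obtain m where m: "m \<in> A" "A - {m} \<subseteq> elems m" using finite_has_max[of A] Suc.prems by blast
  have Am: "A \<inter> elems m = A - {m}" using m mem_irrefl by auto
  have IH: "otp (A \<inter> elems m) = ord_of_nat n"
  proof -
    have "n = card (A - {m})" using Suc.hyps(2) Suc.prems(1) m(1) by simp
    then show ?thesis using Suc.hyps(1)[of "A - {m}"] Suc.prems Am by auto
  qed
  have sub: "elems x \<subseteq> elems m" if "x \<in> A \<inter> elems m" for x
    using that Ord_subset[OF Ord_below[of m], of x] m Suc.prems by blast
  have "elems (otp A) = insert (otp (A \<inter> elems m)) ((\<lambda>x. otp (A \<inter> elems x)) ` (A \<inter> elems m))"
  proof -
    have "A = insert m (A \<inter> elems m)" using m(1) Am by blast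
    then have "(\<lambda>x. otp (A \<inter> elems x)) ` A = (\<lambda>x. otp (A \<inter> elems x)) ` insert m (A \<inter> elems m)"
      by (rule arg_cong)
    then show ?thesis by (simp only: elems_otp_below[OF Suc.prems(2)] image_insert)
  qed
  also have "(\<lambda>x. otp (A \<inter> elems x)) ` (A \<inter> elems m)
      = (\<lambda>x. otp (A \<inter> elems m \<inter> elems x)) ` (A \<inter> elems m)"
  proof (intro image_cong refl)
    fix x assume "x \<in> A \<inter> elems m"
    then have "A \<inter> elems x = A \<inter> elems m \<inter> elems x" using sub by blast
    then show "otp (A \<inter> elems x) = otp (A \<inter> elems m \<inter> elems x)" by simp
  qed
  also have "\<dots> = elems (otp (A \<inter> elems m))"
    by (rule elems_otp_below[symmetric]) (use Suc.prems in blast)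
  also have "insert (otp (A \<inter> elems m)) \<dots> = elems (ord_of_nat (Suc n))"
    unfolding IH by (simp add: ord_of_nat_def elems_osucc)
  finally show ?case using Suc.hyps(2) elems_inject by metis
qed

lemma otp_eq_ord_of_nat_iff:
  assumes "A \<subseteq> elems \<kappa>"
  shows "otp A = ord_of_nat n \<longleftrightarrow> finite A \<and> card A = n"
proof
  assume eq: "otp A = ord_of_nat n"
  obtain f where "bij_betw f A (elems (otp A))"
    using otp_iso_below[OF assms] unfolding otp_iso_def by blast
  then show "finite A \<and> card A = n"
    using bij_betw_finite bij_betw_same_card finite_ord_of_nat[of n] unfolding eq by metis
qed (use otp_finite assms in blast)

text \<open>Trades order types for counting predecessors. The lower bound 1 comes from
  \<open>Suc j\<close>: the least element of \<open>A\<close> is never a successor.\<close>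

lemma succ_n_eq:
  assumes A: "A \<subseteq> elems \<kappa>"
  shows "succ_n n A =
    {\<delta> \<in> A. finite (A \<inter> elems \<delta>) \<and> 1 \<le> card (A \<inter> elems \<delta>) \<and> card (A \<inter> elems \<delta>) \<le> n}"
proof -
  have iff: "otp (A \<inter> elems \<delta>) = ord_of_nat k \<longleftrightarrow> finite (A \<inter> elems \<delta>) \<and> card (A \<inter> elems \<delta>) = k"
    for \<delta> k by (rule otp_eq_ord_of_nat_iff) (use A in blast)
  have less: "card (A \<inter> elems \<delta>) < card (A \<inter> elems \<delta>')"
    if "\<delta> \<in> A" "\<delta>' \<in> A" "\<delta> \<in> elems \<delta>'" "finite (A \<inter> elems \<delta>')" for \<delta> \<delta>'
  proof (rule psubset_card_mono[OF that(4)])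
    have "elems \<delta> \<subseteq> elems \<delta>'" using that A Ord_subset[OF Ord_below[of \<delta>']] by blast
    then show "A \<inter> elems \<delta> \<subset> A \<inter> elems \<delta>'" using that mem_irrefl[of \<delta>] by blast
  qed
  \<comment> \<open>Elements with equally many predecessors coincide, which is what the description
    in \<open>elt\<close> requires.\<close>
  have uniq: "\<delta> = \<delta>'" if "\<delta> \<in> A" "\<delta>' \<in> A" "otp (A \<inter> elems \<delta>) = ord_of_nat k"
    "otp (A \<inter> elems \<delta>') = ord_of_nat k" for \<delta> \<delta>' k
    using less[of \<delta> \<delta>'] less[of \<delta>' \<delta>] that below_linear[of \<delta> \<delta>'] A unfolding iff by auto
  have elt: "elt A (ord_of_nat k) = \<delta>" if "\<delta> \<in> A" "otp (A \<inter> elems \<delta>) = ord_of_nat k" for \<delta> k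
    unfolding elt_def using that uniq by (intro the_equality) auto
  show ?thesis
  proof (intro equalityI subsetI)
    fix x assume "x \<in> succ_n n A"
    then obtain j where j: "x = elt A (ord_of_nat (Suc j))" "j < n"
        "ord_of_nat (Suc j) \<in> elems (otp A)"
      unfolding succ_n_def by blast
    then obtain \<delta> where \<delta>: "\<delta> \<in> A" "otp (A \<inter> elems \<delta>) = ord_of_nat (Suc j)"
      using elems_otp_below[OF A] by auto
    then show "x \<in> {\<delta> \<in> A. finite (A \<inter> elems \<delta>) \<and> 1 \<le> card (A \<inter> elems \<delta>) \<and> card (A \<inter> elems \<delta>) \<le> n}"
      using elt[OF \<delta>] j iff[of \<delta> "Suc j"] by auto
  next
    fix x assume x: "x \<in> {\<delta> \<in> A. finite (A \<inter> elems \<delta>) \<and> 1 \<le> card (A \<inter> elems \<delta>) \<and> card (A \<inter> elems \<delta>) \<le> n}"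
    then obtain j where j: "card (A \<inter> elems x) = Suc j" "j < n"
      by (cases "card (A \<inter> elems x)") auto
    then have o: "otp (A \<inter> elems x) = ord_of_nat (Suc j)" using x iff by auto
    then have "ord_of_nat (Suc j) \<in> elems (otp A)"
      using elems_otp_below[OF A] x by force
    moreover have "x = elt A (ord_of_nat (Suc j))" using elt[OF _ o] x by auto
    ultimately show "x \<in> succ_n n A" unfolding succ_n_def using j(2) by blast
  qed
qed

section \<open>Hereditarily small sets\<close>

lemma tc_eq: "tc x = elems x \<union> (\<Union>y\<in>elems x. tc y)"
  unfolding tc_def
proof (intro equalityI subsetI)
  fix y assume "y \<in> {y. (y, x) \<in> mem\<^sup>+}"
  then have "(y, x) \<in> mem\<^sup>+" by simp
  then show "y \<in> elems x \<union> (\<Union>y\<in>elems x. {z. (z, y) \<in> mem\<^sup>+})"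
    by (cases rule: tranclE) (auto simp: mem_def)
next
  fix y assume "y \<in> elems x \<union> (\<Union>y\<in>elems x. {z. (z, y) \<in> mem\<^sup>+})"
  then show "y \<in> {y. (y, x) \<in> mem\<^sup>+}"
    by (auto simp: mem_def intro: trancl_into_trancl)
qed

lemma elems_H_small: "x \<in> H \<kappa> \<Longrightarrow> small (elems x)"
proof -
  assume "x \<in> H \<kappa>"
  moreover have "elems x \<subseteq> tc x" using tc_eq[of x] by blast
  ultimately show ?thesis unfolding Hered_def using small_subset by blast
qed

lemma elem_H: "x \<in> H \<kappa> \<Longrightarrow> y \<in> elems x \<Longrightarrow> y \<in> H \<kappa>"
proof -
  assume "x \<in> H \<kappa>" "y \<in> elems x"
  moreover from this have "tc y \<subseteq> tc x" using tc_eq[of x] by blast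
  ultimately show ?thesis unfolding Hered_def using small_subset[of "tc y" "tc x"] by blast
qed

text \<open>The transitive closure is a small union of small sets, so regularity applies. This puts
  traces of small hulls into \<open>H \<kappa>\<close>.\<close>

lemma H_closed_small:
  assumes "X \<subseteq> H \<kappa>" "small X"
  shows "\<exists>x\<in>H \<kappa>. elems x = X"
proof -
  have "|X| \<le>o |UNIV :: 'k set|"
    using assms(2) card_elems[of \<kappa>] ordLess_imp_ordLeq ordLeq_transitive by metis
  then obtain x :: "'k hset" where x: "elems x = X" using ex_elems_iff by blast
  have "small (\<Union>y\<in>X. tc y)"
    by (rule small_UN[OF assms(2)]) (use assms(1) in \<open>auto simp: Hered_def\<close>)
  then have "small (tc x)" unfolding tc_eq[of x] x by (rule small_Un[OF assms(2)])
  then show ?thesis using x by (auto simp: Hered_def)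
qed

lemma ozero_H: "ozero \<in> H \<kappa>"
  using H_closed_small[of "{}"] small_finite[of "{}"] elems_ozero elems_inject
  by (metis empty_subsetI finite.emptyI)

lemma below_Hplus: "elems \<kappa> \<subseteq> Hplus \<kappa>"
proof
  fix x assume x: "x \<in> elems \<kappa>"
  have "tc x \<subseteq> elems \<kappa>"
  proof
    fix y assume "y \<in> tc x"
    then have "(y, x) \<in> mem\<^sup>+" by (simp add: tc_def)
    then show "y \<in> elems \<kappa>"
      by (induction rule: converse_trancl_induct) (use x below_subset in \<open>auto simp: mem_def\<close>)
  qed
  then have "|tc x| \<le>o |elems \<kappa>|" by (rule card_of_mono1)
  then show "x \<in> Hplus \<kappa>"
    unfolding Hered_def using cardSuc_greater[OF card_of_Card_order] ordLeq_ordLess_trans by blast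
qed

section \<open>Coding hereditarily small sets by ordinals\<close>

text \<open>A small set has order type below \<kappa>, so the inverse of its collapse is one of the
  sequences counted by \<open>seqs_below\<close>.\<close>

lemma small_enumeration:
  assumes "X \<subseteq> elems \<kappa>" "small X"
  shows "\<exists>s\<in>seqs_below \<kappa>. ran s = X"
proof -
  obtain f where f: "otp_iso X (otp X) f" using otp_iso_below[OF assms(1)] by blast
  have "\<not> elems \<kappa> \<subseteq> elems (otp X)"
  proof
    assume "elems \<kappa> \<subseteq> elems (otp X)"
    then have "|elems \<kappa>| \<le>o |X|"
      using card_otp[OF assms(1)] card_of_mono1 ordIso_symmetric ordLeq_ordIso_trans by metis
    then show False using assms(2) not_small_iff by blast
  qed
  then have a: "otp X \<in> elems \<kappa>"
    using Ord_linear[OF Ord_otp[OF assms(1)] Ord_\<kappa>] Ord_subset[OF Ord_otp[OF assms(1)]] by blast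
  have b: "bij_betw f X (elems (otp X))" using f by (simp add: otp_iso_def)
  define s where "s y = (if y \<in> elems (otp X) then Some (inv_into X f y) else None)" for y
  have "ran s = inv_into X f ` elems (otp X)" unfolding s_def ran_def by auto
  also have "\<dots> = X" using b by (metis bij_betw_def bij_betw_inv_into)
  finally have r: "ran s = X" .
  have "dom s = elems (otp X)" unfolding s_def dom_def by auto
  then have "s \<in> seqs_below \<kappa>" using a r assms(1) unfolding seqs_below_def by blast
  then show ?thesis using r by blast
qed

text \<open>Each member of \<open>H \<kappa>\<close> is coded, by recursion on membership, by an enumeration of the codes
  of its members.\<close>

lemma card_H:
  assumes "|seqs_below \<kappa>| \<le>o |elems \<kappa>|"
  shows "|H \<kappa>| \<le>o |elems \<kappa>|"
proof -
  obtain e where e: "inj_on e (seqs_below \<kappa>)" "e ` seqs_below \<kappa> \<subseteq> elems \<kappa>"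
    using assms card_of_ordLeq[of "seqs_below \<kappa>" "elems \<kappa>"] by blast
  \<comment> \<open>One fixed enumeration per small set, so that the code of \<open>x\<close> is a
    function of the set of codes of its elements.\<close>
  define en where "en X = (SOME s. s \<in> seqs_below \<kappa> \<and> ran s = X)" for X
  have en: "en X \<in> seqs_below \<kappa> \<and> ran (en X) = X" if "X \<subseteq> elems \<kappa>" "small X" for X
    using someI_ex[of "\<lambda>s. s \<in> seqs_below \<kappa> \<and> ran s = X"] small_enumeration[OF that]
    unfolding en_def by blast
  define code :: "'k hset \<Rightarrow> 'k hset" where "code = wfrec mem (\<lambda>g x. e (en (g ` elems x)))"
  have code: "code x = e (en (code ` elems x))" for x
  proof -
    have "code x = e (en (cut code mem x ` elems x))"
      unfolding code_def by (subst wfrec[OF wf_mem]) simp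
    also have "cut code mem x ` elems x = code ` elems x"
      by (intro image_cong) (auto simp: cut_def mem_def)
    finally show ?thesis .
  qed
  have in\<kappa>: "x \<in> H \<kappa> \<longrightarrow> code x \<in> elems \<kappa>" for x
  proof (induction x rule: hset_induct)
    case (1 x)
    show ?case
    proof
      assume x: "x \<in> H \<kappa>"
      then have "code ` elems x \<subseteq> elems \<kappa>" using 1 elem_H by blast
      then have "en (code ` elems x) \<in> seqs_below \<kappa>"
        using en[of "code ` elems x"] small_image[OF elems_H_small[OF x], of code] by blast
      then show "code x \<in> elems \<kappa>" unfolding code[of x] using e(2) by blast
    qed
  qed
  have en': "en (code ` elems x) \<in> seqs_below \<kappa> \<and> ran (en (code ` elems x)) = code ` elems x"
    if "x \<in> H \<kappa>" for x
  proof (rule en)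
    show "code ` elems x \<subseteq> elems \<kappa>" using in\<kappa> elem_H[OF that] by blast
    show "small (code ` elems x)" by (rule small_image[OF elems_H_small[OF that]])
  qed
  \<comment> \<open>\<open>e\<close> is injective, so equal codes come from equal enumerations, and
    these have equal ranges.\<close>
  have img: "code ` elems x = code ` elems y" if "x \<in> H \<kappa>" "y \<in> H \<kappa>" "code x = code y" for x y
  proof -
    have "en (code ` elems x) = en (code ` elems y)"
      using that(3) en'[OF that(1)] en'[OF that(2)]
      by (intro inj_onD[OF e(1)]) (auto simp: code[symmetric])
    then show ?thesis using en'[OF that(1)] en'[OF that(2)] by metis
  qed
  \<comment> \<open>Induction on \<open>x\<close> against all \<open>y\<close> at once:
    \<open>img\<close> pairs the elements of \<open>x\<close> and \<open>y\<close> with equal codes,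
    and the induction hypothesis identifies the members of each pair.\<close>
  have inj: "\<forall>y\<in>H \<kappa>. x \<in> H \<kappa> \<longrightarrow> code x = code y \<longrightarrow> x = y" for x
  proof (induction x rule: hset_induct)
    case (1 x)
    show ?case
    proof (intro ballI impI)
      fix y assume y: "y \<in> H \<kappa>" and x: "x \<in> H \<kappa>" and c: "code x = code y"
      have IH: "u = v" if "u \<in> elems x" "v \<in> elems y" "code u = code v" for u v
        using 1[OF that(1)] elem_H[OF x that(1)] elem_H[OF y that(2)] that(3) by blast
      have "elems x = elems y"
        using img[OF x y c] IH by (auto simp: image_iff set_eq_iff) metis+
      then show "x = y" using elems_inject by blast
    qed
  qed
  show ?thesis
    by (rule card_of_ordLeqI[of code]) (use inj in\<kappa> in \<open>auto simp: inj_on_def\<close>)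
qed

text \<open>Closure points of a function taking each ordinal to a larger one have no greatest
  element, so they are limits.\<close>

lemma limits_cofinal:
  assumes "e \<in> elems \<kappa>"
  shows "\<exists>\<beta>\<in>acc (elems \<kappa>). e \<in> elems \<beta>"
proof -
  have "\<forall>a\<in>elems \<kappa>. \<exists>b. b \<in> elems \<kappa> \<and> a \<in> elems b" using exists_above by blast
  from bchoice[OF this] obtain nx where nx: "\<forall>a\<in>elems \<kappa>. nx a \<in> elems \<kappa> \<and> a \<in> elems (nx a)" ..
  define E where "E = {\<beta> \<in> elems \<kappa>. ozero \<in> elems \<beta> \<and> (\<forall>\<gamma>\<in>elems \<beta>. {nx \<gamma>} \<subseteq> elems \<beta>)}"
  have "club_in \<kappa> E"
    unfolding E_def by (rule club_closure_points) (use nx in \<open>auto intro: small_finite\<close>)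
  then have "cofinal_in \<kappa> E" by (simp add: club_in_def)
  then obtain \<beta> where \<beta>: "\<beta> \<in> E" "e \<in> elems \<beta>" using assms unfolding cofinal_in_\<kappa>_iff by blast
  have b\<kappa>: "\<beta> \<in> elems \<kappa>" using \<beta> by (simp add: E_def)
  have "(\<Union>a\<in>elems \<kappa> \<inter> elems \<beta>. elems a) = elems \<beta>"
  proof (intro equalityI subsetI)
    fix x assume "x \<in> (\<Union>a\<in>elems \<kappa> \<inter> elems \<beta>. elems a)"
    then show "x \<in> elems \<beta>" using below_trans[OF b\<kappa>] by blast
  next
    fix x assume x: "x \<in> elems \<beta>"
    then have "nx x \<in> elems \<beta>" using \<beta> by (auto simp: E_def)
    moreover have "x \<in> elems (nx x)" "nx x \<in> elems \<kappa>" using nx x below_subset[OF b\<kappa>] by auto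
    ultimately show "x \<in> (\<Union>a\<in>elems \<kappa> \<inter> elems \<beta>. elems a)" by blast
  qed
  then have "osup (elems \<kappa> \<inter> elems \<beta>) = \<beta>" by (subst osup_eq_iff) auto
  then have "\<beta> \<in> acc (elems \<kappa>)" using \<beta> by (auto simp: acc_def E_def)
  then show ?thesis using \<beta>(2) by blast
qed

lemma acc_\<kappa>_not_small: "\<not> small (acc (elems \<kappa>))"
proof
  assume "small (acc (elems \<kappa>))"
  moreover have "acc (elems \<kappa>) \<subseteq> elems \<kappa>" by (auto simp: acc_def)
  ultimately obtain b where b: "b \<in> elems \<kappa>" "acc (elems \<kappa>) \<subseteq> elems b"
    using small_bounded[of "acc (elems \<kappa>)"] by blast
  then obtain \<beta> where "\<beta> \<in> acc (elems \<kappa>)" "b \<in> elems \<beta>" using limits_cofinal by blast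
  then show False using b mem_asym by blast
qed

text \<open>The limit ordinals code triples rather than pairs. The additional first coordinate gives
  every pair \<kappa> many codes, too many for all of them to lie below
  \<open>\<beta>\<close>.\<close>

lemma exists_coding:
  assumes "|H \<kappa>| \<le>o |elems \<kappa>|"
  shows "\<exists>bt xv. (\<forall>\<delta>. xv \<delta> \<in> H \<kappa>) \<and>
    (\<forall>\<beta>\<in>elems \<kappa>. \<forall>x\<in>H \<kappa>. \<exists>\<delta>\<in>acc (elems \<kappa>). ole \<beta> \<delta> \<and> bt \<delta> = \<beta> \<and> xv \<delta> = x)"
proof -
  let ?T = "elems \<kappa> \<times> (elems \<kappa> \<times> H \<kappa>)"
  have "|elems \<kappa> \<times> H \<kappa>| \<le>o |elems \<kappa>|"
    by (rule card_of_Sigma_ordLeq_infinite[OF infinite_\<kappa>]) (use assms card_of_refl[THEN ordIso_imp_ordLeq] in auto)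
  then have "|?T| \<le>o |elems \<kappa>|"
    by (intro card_of_Sigma_ordLeq_infinite[OF infinite_\<kappa>]) (auto intro: card_of_refl[THEN ordIso_imp_ordLeq])
  then have "|?T| \<le>o |acc (elems \<kappa>)|"
    using acc_\<kappa>_not_small not_small_iff ordLeq_transitive by blast
  then obtain j where j: "inj_on j ?T" "j ` ?T \<subseteq> acc (elems \<kappa>)"
    using card_of_ordLeq[of ?T "acc (elems \<kappa>)"] by blast
  define bt where "bt \<delta> = fst (snd (inv_into ?T j \<delta>))" for \<delta>
  \<comment> \<open>Off the range of \<open>j\<close> the value must still belong to
    \<open>H \<kappa>\<close>, hence the default.\<close>
  define xv where "xv \<delta> = (if \<delta> \<in> j ` ?T then snd (snd (inv_into ?T j \<delta>)) else ozero)" for \<delta>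
  have "xv \<delta> \<in> H \<kappa>" for \<delta>
    unfolding xv_def using inv_into_into[of \<delta> j ?T] ozero_H by auto
  moreover have "\<exists>\<delta>\<in>acc (elems \<kappa>). ole \<beta> \<delta> \<and> bt \<delta> = \<beta> \<and> xv \<delta> = x"
    if \<beta>: "\<beta> \<in> elems \<kappa>" and x: "x \<in> H \<kappa>" for \<beta> x
  proof -
    let ?D = "(\<lambda>\<eta>. j (\<eta>, \<beta>, x)) ` elems \<kappa>"
    have D: "?D \<subseteq> acc (elems \<kappa>)" using j(2) \<beta> x by blast
    have "inj_on (\<lambda>\<eta>. j (\<eta>, \<beta>, x)) (elems \<kappa>)"
      by (rule inj_onI) (use inj_onD[OF j(1)] \<beta> x in blast)
    then have "|elems \<kappa>| \<le>o |?D|" by (rule card_of_ordLeqI) blast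
    then have "\<not> ?D \<subseteq> elems \<beta>" using small_below[OF \<beta>] not_small_iff by blast
    then obtain \<eta> where \<eta>: "\<eta> \<in> elems \<kappa>" "j (\<eta>, \<beta>, x) \<notin> elems \<beta>" by blast
    have T: "(\<eta>, \<beta>, x) \<in> ?T" using \<eta> \<beta> x by blast
    have a: "j (\<eta>, \<beta>, x) \<in> acc (elems \<kappa>)" using j(2) T by blast
    then have "j (\<eta>, \<beta>, x) \<in> elems \<kappa>" by (simp add: acc_def)
    then have "ole \<beta> (j (\<eta>, \<beta>, x))" using below_linear[OF \<beta>] \<eta>(2) unfolding ole_def by blast
    moreover have "bt (j (\<eta>, \<beta>, x)) = \<beta>" "xv (j (\<eta>, \<beta>, x)) = x"
      unfolding bt_def xv_def using inv_into_f_f[OF j(1) T] T by auto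
    ultimately show ?thesis using a by blast
  qed
  ultimately show ?thesis by blast
qed

end

section \<open>Skolem hulls\<close>

text \<open>Countably many formulas yield countably many Skolem functions, which keeps hulls of
  small sets small.\<close>

instance fm :: countable
  by countable_datatype

text \<open>Bounds the indices in atomic subformulas, so that by \<open>sat_cong\<close> a finite
  list can stand in for an assignment.\<close>

primrec var_bound :: "fm \<Rightarrow> nat" where
  "var_bound (Mem i j) = Suc (max i j)"
| "var_bound (Equal i j) = Suc (max i j)"
| "var_bound (Neg \<phi>) = var_bound \<phi>"
| "var_bound (Conj \<phi> \<psi>) = max (var_bound \<phi>) (var_bound \<psi>)"
| "var_bound (Forall i \<phi>) = var_bound \<phi>"

lemma sat_cong: "(\<And>i. i < var_bound \<phi> \<Longrightarrow> s i = t i) \<Longrightarrow> sat M \<phi> s \<longleftrightarrow> sat M \<phi> t"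
proof (induction \<phi> arbitrary: s t)
  case (Neg \<phi>)
  have "sat M \<phi> s \<longleftrightarrow> sat M \<phi> t" by (rule Neg.IH) (use Neg.prems in simp)
  then show ?case by simp
next
  case (Conj \<phi> \<psi>)
  have "sat M \<phi> s \<longleftrightarrow> sat M \<phi> t" by (rule Conj.IH(1)) (use Conj.prems in simp)
  moreover have "sat M \<psi> s \<longleftrightarrow> sat M \<psi> t" by (rule Conj.IH(2)) (use Conj.prems in simp)
  ultimately show ?case by simp
next
  case (Forall i \<phi>)
  have "sat M \<phi> (s(i := x)) \<longleftrightarrow> sat M \<phi> (t(i := x))" for x
    by (rule Forall.IH) (use Forall.prems in simp)
  then show ?case by simp
qed auto

text \<open>A Skolem function for negated universal quantifiers, since \<open>Forall\<close> is the
  primitive quantifier. The parameter list \<open>l\<close> acts as an assignment through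
  \<open>(!) l\<close>, which is unspecified beyond its length.\<close>

definition counterexample :: "'k hset set \<Rightarrow> fm \<Rightarrow> nat \<Rightarrow> 'k hset list \<Rightarrow> 'k hset" where
  "counterexample N \<phi> i l = (SOME x. x \<in> N \<and> \<not> sat N \<phi> (((!) l)(i := x)))"

inductive_set skolem_hull :: "'k hset set \<Rightarrow> 'k hset set \<Rightarrow> 'k hset set" for N X where
  base: "x \<in> X \<Longrightarrow> x \<in> skolem_hull N X"
| step: "(\<forall>y\<in>set l. y \<in> skolem_hull N X) \<Longrightarrow> \<exists>x\<in>N. \<not> sat N \<phi> (((!) l)(i := x)) \<Longrightarrow>
    counterexample N \<phi> i l \<in> skolem_hull N X"

lemma counterexample:
  assumes "\<exists>x\<in>N. \<not> sat N \<phi> (((!) l)(i := x))"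
  shows "counterexample N \<phi> i l \<in> N \<and> \<not> sat N \<phi> (((!) l)(i := counterexample N \<phi> i l))"
  using someI_ex[of "\<lambda>x. x \<in> N \<and> \<not> sat N \<phi> (((!) l)(i := x))"] assms
  unfolding counterexample_def by blast

lemma skolem_hull_subset: "X \<subseteq> N \<Longrightarrow> skolem_hull N X \<subseteq> N"
proof
  fix x assume X: "X \<subseteq> N" and "x \<in> skolem_hull N X"
  from this(2) show "x \<in> N"
  proof induction
    case (base x)
    then show ?case using X by blast
  next
    case (step l \<phi> i)
    then show ?case using counterexample[OF step(2)] by blast
  qed
qed

lemma skolem_hull_mono: "X \<subseteq> Y \<Longrightarrow> skolem_hull N X \<subseteq> skolem_hull N Y"
proof
  fix x assume X: "X \<subseteq> Y" and "x \<in> skolem_hull N X"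
  from this(2) show "x \<in> skolem_hull N Y"
  proof induction
    case (base x)
    then show ?case using X by (blast intro: skolem_hull.base)
  next
    case (step l \<phi> i)
    show ?case by (rule skolem_hull.step) (use step in blast)+
  qed
qed

text \<open>The Tarski-Vaught test: a universal formula that fails in \<open>N\<close> fails at a
  counterexample belonging to the hull.\<close>

lemma skolem_hull_elem_submodel:
  assumes "X \<subseteq> N" "X \<noteq> {}"
  shows "skolem_hull N X \<prec> N"
proof -
  let ?M = "skolem_hull N X"
  have sub: "?M \<subseteq> N" using skolem_hull_subset[OF assms(1)] .
  have "sat ?M \<phi> s \<longleftrightarrow> sat N \<phi> s" if "range s \<subseteq> ?M" for \<phi> s
    using that
  proof (induction \<phi> arbitrary: s)
    case (Forall i \<phi>)
    have IH: "sat ?M \<phi> (s(i := x)) \<longleftrightarrow> sat N \<phi> (s(i := x))" if "x \<in> ?M" for x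
      by (rule Forall.IH) (use Forall.prems that in auto)
    \<comment> \<open>The formula sees only these values of \<open>s\<close>, so the assignment may
      be replaced by a list over the hull.\<close>
    let ?l = "map s [0..<var_bound \<phi>]"
    have cong: "sat N \<phi> (((!) ?l)(i := x)) \<longleftrightarrow> sat N \<phi> (s(i := x))" for x
      by (rule sat_cong) simp
    have "\<exists>x\<in>?M. \<not> sat N \<phi> (s(i := x))" if "\<exists>x\<in>N. \<not> sat N \<phi> (s(i := x))"
    proof -
      have ex: "\<exists>x\<in>N. \<not> sat N \<phi> (((!) ?l)(i := x))" using that cong by blast
      have "counterexample N \<phi> i ?l \<in> ?M"
        by (rule skolem_hull.step) (use ex Forall.prems in auto)
      then show ?thesis using counterexample[OF ex] cong by blast
    qed
    then show ?case using IH sub by auto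
  qed auto
  then show ?thesis
    unfolding elem_submodel_def using sub assms(2) skolem_hull.base[of _ X N] by blast
qed

context regular_cardinal
begin

text \<open>The hull is exhausted by countably many stages, each adding the values of countably many
  Skolem functions at lists over the previous stage.\<close>

lemma small_skolem_hull:
  assumes "small X"
  shows "small (skolem_hull N X)"
proof -
  define W where "W A = (\<Union>q\<in>(UNIV :: (fm \<times> nat) set). (\<lambda>l. counterexample N (fst q) (snd q) l) ` lists A)" for A
  define h where "h n = ((\<lambda>A. A \<union> W A) ^^ n) X" for n
  have h0: "h 0 = X" and hS: "h (Suc n) = h n \<union> W (h n)" for n
    by (simp_all add: h_def)
  have W: "small (W A)" if "small A" for A
    unfolding W_def by (intro small_UN small_countable small_image[OF small_lists[OF that]]) simp
  have h: "small (h n)" for n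
    by (induction n) (auto simp: h0 hS assms intro: small_Un W)
  have mono: "h m \<subseteq> h n" if "m \<le> n" for m n
    using that by (induction rule: dec_induct) (auto simp: hS)
  have "skolem_hull N X \<subseteq> (\<Union>n. h n)"
  proof
    fix x assume "x \<in> skolem_hull N X"
    then show "x \<in> (\<Union>n. h n)"
    proof induction
      case (base x)
      then show ?case using h0 by blast
    next
      case (step l \<phi> i)
      then have "\<forall>y\<in>set l. \<exists>n. y \<in> h n" by blast
      from bchoice[OF this] obtain f where f: "\<forall>y\<in>set l. y \<in> h (f y)" ..
      \<comment> \<open>A stage containing all parameters; the inserted 0 covers the empty
        list.\<close>
      define n where "n = Max (insert 0 (f ` set l))"
      have "y \<in> h n" if "y \<in> set l" for y
      proof -
        have "f y \<le> n" unfolding n_def using that by (intro Max_ge) auto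
        then show ?thesis using f that mono by blast
      qed
      then have "l \<in> lists (h n)" by auto
      then have "counterexample N (fst (\<phi>, i)) (snd (\<phi>, i)) l \<in> W (h n)"
        unfolding W_def by blast
      then have "counterexample N \<phi> i l \<in> h (Suc n)" unfolding hS by simp
      then show ?case by blast
    qed
  qed
  moreover have "small (\<Union>n. h n)"
    by (rule small_UN) (auto intro: small_countable h)
  ultimately show ?thesis by (rule small_subset)
qed

text \<open>Continuity of hulls: a member is generated from finitely many ordinals, and below a
  limit these have a common strict bound.\<close>

lemma skolem_hull_limit:
  assumes \<beta>: "\<beta> \<in> elems \<kappa>" "ozero \<in> elems \<beta>" and lim: "\<And>\<gamma>. \<gamma> \<in> elems \<beta> \<Longrightarrow> \<exists>\<gamma>'\<in>elems \<beta>. \<gamma> \<in> elems \<gamma>'"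
    and "x \<in> skolem_hull N (insert p (elems \<beta>))"
  shows "\<exists>\<gamma>\<in>elems \<beta>. x \<in> skolem_hull N (insert p (elems \<gamma>))"
  using assms(4)
proof induction
  case (base x)
  show ?case
  proof (cases "x = p")
    case True
    then show ?thesis using \<beta>(2) skolem_hull.base by blast
  next
    case False
    then obtain \<gamma> where "\<gamma> \<in> elems \<beta>" "x \<in> elems \<gamma>" using lim base by blast
    then show ?thesis using skolem_hull.base[of x "insert p (elems \<gamma>)"] by blast
  qed
next
  case (step l \<phi> i)
  \<comment> \<open>The bounds of the single parameters are merged by induction on the list, using
    that hulls increase with the ordinal.\<close>
  have "\<exists>\<gamma>\<in>elems \<beta>. \<forall>y\<in>set l. y \<in> skolem_hull N (insert p (elems \<gamma>))"
    using step(1)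
  proof (induction l)
    case Nil
    then show ?case using \<beta>(2) by auto
  next
    case (Cons y l)
    then obtain \<gamma> \<gamma>' where g: "\<gamma> \<in> elems \<beta>" "\<forall>y\<in>set l. y \<in> skolem_hull N (insert p (elems \<gamma>))"
      "\<gamma>' \<in> elems \<beta>" "y \<in> skolem_hull N (insert p (elems \<gamma>'))"
      by auto
    then have \<kappa>: "\<gamma> \<in> elems \<kappa>" "\<gamma>' \<in> elems \<kappa>" using below_subset[OF \<beta>(1)] by auto
    have "elems \<gamma> \<subseteq> elems \<gamma>' \<or> elems \<gamma>' \<subseteq> elems \<gamma>"
      using below_linear[OF \<kappa>] Ord_subset[OF Ord_below[OF \<kappa>(1)]] Ord_subset[OF Ord_below[OF \<kappa>(2)]] by blast
    then show ?case
    proof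
      assume "elems \<gamma> \<subseteq> elems \<gamma>'"
      then have "skolem_hull N (insert p (elems \<gamma>)) \<subseteq> skolem_hull N (insert p (elems \<gamma>'))"
        by (intro skolem_hull_mono) blast
      then show ?thesis using g by auto
    next
      assume "elems \<gamma>' \<subseteq> elems \<gamma>"
      then have "skolem_hull N (insert p (elems \<gamma>')) \<subseteq> skolem_hull N (insert p (elems \<gamma>))"
        by (intro skolem_hull_mono) blast
      then show ?thesis using g by auto
    qed
  qed
  then show ?case using skolem_hull.step[OF _ step(2)] by blast
qed

section \<open>Cofinal sets of codes for a given triple\<close>

text \<open>A code \<open>d \<beta>\<close> is picked for every \<open>\<beta>\<close>, and the
  codes of suitable \<open>\<beta>\<close> in \<open>S\<close> are kept. Suitable means that the
  hull meets \<kappa> in \<open>\<beta>\<close> and that \<open>\<beta>\<close> is closed under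
  \<open>d\<close>; a club of \<open>\<beta>\<close> above any given bound has both properties, and
  \<open>S\<close> meets it.\<close>

lemma cofinal_set_of_codes:
  assumes p: "p \<in> Hplus \<kappa>" and \<Omega>: "\<Omega> \<subseteq> H \<kappa>" and S: "stationary_in \<kappa> S"
    and coding: "\<And>\<beta> x. \<beta> \<in> elems \<kappa> \<Longrightarrow> x \<in> H \<kappa> \<Longrightarrow>
      \<exists>\<delta>\<in>acc (elems \<kappa>). ole \<beta> \<delta> \<and> bt \<delta> = \<beta> \<and> xv \<delta> = x"
  shows "\<exists>A. cofinal_in \<kappa> A \<and> A \<subseteq> acc (elems \<kappa>) \<and>
    (\<forall>\<delta>\<in>A. ole (bt \<delta>) \<delta> \<and> bt \<delta> \<in> S \<and>
      (\<exists>M. M \<prec> Hplus \<kappa> \<and> p \<in> M \<and> M \<inter> elems \<kappa> = elems (bt \<delta>) \<and> M \<inter> \<Omega> = elems (xv \<delta>))) \<and>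
    (\<forall>\<delta>\<in>A. \<forall>\<delta>'\<in>A. \<delta> \<in> elems \<delta>' \<longrightarrow> \<delta> \<in> elems (bt \<delta>'))"
proof -
  \<comment> \<open>The ordinals below \<open>\<beta>\<close>, not \<open>\<beta>\<close> itself,
    are thrown into the hull, so that \<open>\<beta>\<close> can be its trace on \<kappa>.\<close>
  define M where "M \<beta> = skolem_hull (Hplus \<kappa>) (insert p (elems \<beta>))" for \<beta>
  have small_M: "small (M \<beta>)" if "\<beta> \<in> elems \<kappa>" for \<beta>
    unfolding M_def
    using small_Un[OF small_finite[of "{p}"] small_below[OF that order_refl]]
    by (intro small_skolem_hull) simp
  have "\<exists>\<delta>. \<delta> \<in> acc (elems \<kappa>) \<and> ole \<beta> \<delta> \<and> bt \<delta> = \<beta> \<and> elems (xv \<delta>) = M \<beta> \<inter> \<Omega>"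
    if \<beta>: "\<beta> \<in> elems \<kappa>" for \<beta>
  proof -
    have "small (M \<beta> \<inter> \<Omega>)" using small_subset[OF _ small_M[OF \<beta>]] by blast
    then obtain x where "x \<in> H \<kappa>" "elems x = M \<beta> \<inter> \<Omega>"
      using H_closed_small[of "M \<beta> \<inter> \<Omega>"] \<Omega> by blast
    then show ?thesis using coding[OF \<beta>] by blast
  qed
  then have "\<forall>\<beta>\<in>elems \<kappa>. \<exists>\<delta>. \<delta> \<in> acc (elems \<kappa>) \<and> ole \<beta> \<delta> \<and> bt \<delta> = \<beta> \<and> elems (xv \<delta>) = M \<beta> \<inter> \<Omega>"
    by blast
  from bchoice[OF this] obtain d where d: "\<forall>\<beta>\<in>elems \<kappa>. d \<beta> \<in> acc (elems \<kappa>) \<and> ole \<beta> (d \<beta>) \<and>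
      bt (d \<beta>) = \<beta> \<and> elems (xv (d \<beta>)) = M \<beta> \<inter> \<Omega>" ..
  have d\<kappa>: "d \<beta> \<in> elems \<kappa>" if "\<beta> \<in> elems \<kappa>" for \<beta>
    using d that by (auto simp: acc_def)
  have "\<forall>a\<in>elems \<kappa>. \<exists>b. b \<in> elems \<kappa> \<and> a \<in> elems b" using exists_above by blast
  from bchoice[OF this] obtain nx where nx: "\<forall>a\<in>elems \<kappa>. nx a \<in> elems \<kappa> \<and> a \<in> elems (nx a)" ..
  have S\<kappa>: "S \<subseteq> elems \<kappa>" using S by (simp add: stationary_in_def)
  \<comment> \<open>Closure under \<open>d\<close> is the thinning: a code picked for an ordinal
    below \<open>\<beta>\<close> lies below \<open>\<beta>\<close>.\<close>
  define G where "G = {\<beta> \<in> S. M \<beta> \<inter> elems \<kappa> = elems \<beta> \<and> (\<forall>\<gamma>\<in>elems \<beta>. d \<gamma> \<in> elems \<beta>)}"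
  have G\<kappa>: "\<beta> \<in> elems \<kappa>" if "\<beta> \<in> G" for \<beta> using that S\<kappa> by (auto simp: G_def)
  have "\<exists>\<beta>\<in>G. e \<in> elems \<beta>" if e: "e \<in> elems \<kappa>" for e
  proof -
    \<comment> \<open>Beyond the two closure demands, \<open>e\<close> forces closure points above
      \<open>e\<close>, and \<open>nx \<gamma>\<close> makes them limits, as
      \<open>skolem_hull_limit\<close> demands.\<close>
    define F where "F \<gamma> = (M \<gamma> \<inter> elems \<kappa>) \<union> {d \<gamma>, e, nx \<gamma>}" for \<gamma>
    define E where "E = {\<beta> \<in> elems \<kappa>. ozero \<in> elems \<beta> \<and> (\<forall>\<gamma>\<in>elems \<beta>. F \<gamma> \<subseteq> elems \<beta>)}"
    have "club_in \<kappa> E"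
      unfolding E_def
    proof (rule club_closure_points)
      fix \<gamma> assume \<gamma>: "\<gamma> \<in> elems \<kappa>"
      have "small (F \<gamma>)"
        unfolding F_def using small_subset[OF Int_lower1 small_M[OF \<gamma>]] small_finite[of "{d \<gamma>, e, nx \<gamma>}"]
        by (intro small_Un) simp_all
      then show "F \<gamma> \<subseteq> elems \<kappa> \<and> small (F \<gamma>)"
        unfolding F_def using \<gamma> e nx d\<kappa> by blast
    qed
    then obtain \<beta> where \<beta>S: "\<beta> \<in> S" and "\<beta> \<in> E" using S unfolding stationary_in_def by blast
    then have \<beta>: "\<beta> \<in> elems \<kappa>" "ozero \<in> elems \<beta>" and F: "\<And>\<gamma>. \<gamma> \<in> elems \<beta> \<Longrightarrow> F \<gamma> \<subseteq> elems \<beta>"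
      by (auto simp: E_def)
    have "M \<beta> \<inter> elems \<kappa> = elems \<beta>"
    proof (intro equalityI subsetI)
      fix x assume x: "x \<in> M \<beta> \<inter> elems \<kappa>"
      have "\<exists>\<gamma>\<in>elems \<beta>. x \<in> M \<gamma>"
        unfolding M_def
      proof (rule skolem_hull_limit[OF \<beta>])
        fix \<gamma> assume \<gamma>: "\<gamma> \<in> elems \<beta>"
        then have "nx \<gamma> \<in> elems \<beta>" using F by (auto simp: F_def)
        moreover have "\<gamma> \<in> elems (nx \<gamma>)" using nx \<gamma> below_subset[OF \<beta>(1)] by blast
        ultimately show "\<exists>\<gamma>'\<in>elems \<beta>. \<gamma> \<in> elems \<gamma>'" by blast
      qed (use x in \<open>simp add: M_def\<close>)
      then show "x \<in> elems \<beta>" using F x by (auto simp: F_def)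
    next
      fix x assume "x \<in> elems \<beta>"
      then show "x \<in> M \<beta> \<inter> elems \<kappa>"
        using below_subset[OF \<beta>(1)] by (auto simp: M_def intro: skolem_hull.base)
    qed
    then have "\<beta> \<in> G" unfolding G_def using \<beta>S F by (auto simp: F_def)
    moreover have "e \<in> elems \<beta>" using F[OF \<beta>(2)] by (auto simp: F_def)
    ultimately show ?thesis by blast
  qed
  note G_cofinal = this
  have "cofinal_in \<kappa> (d ` G)"
    unfolding cofinal_in_\<kappa>_iff
  proof (intro conjI ballI)
    show "d ` G \<subseteq> elems \<kappa>" using d\<kappa> G\<kappa> by blast
    fix e assume "e \<in> elems \<kappa>"
    then obtain \<beta> where \<beta>: "\<beta> \<in> G" "e \<in> elems \<beta>" using G_cofinal by blast
    have "ole \<beta> (d \<beta>)" using d G\<kappa>[OF \<beta>(1)] by blast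
    then have "e \<in> elems (d \<beta>)"
      using \<beta>(2) ole_below_iff[OF G\<kappa>[OF \<beta>(1)] d\<kappa>[OF G\<kappa>[OF \<beta>(1)]]] by blast
    then show "\<exists>a\<in>d ` G. e \<in> elems a" using \<beta>(1) by blast
  qed
  moreover have "d ` G \<subseteq> acc (elems \<kappa>)" using d G\<kappa> by blast
  moreover have "ole (bt \<delta>) \<delta> \<and> bt \<delta> \<in> S \<and>
      (\<exists>M. M \<prec> Hplus \<kappa> \<and> p \<in> M \<and> M \<inter> elems \<kappa> = elems (bt \<delta>) \<and> M \<inter> \<Omega> = elems (xv \<delta>))"
    if "\<delta> \<in> d ` G" for \<delta>
  proof -
    obtain \<beta> where \<beta>: "\<beta> \<in> G" "\<delta> = d \<beta>" using \<open>\<delta> \<in> d ` G\<close> by blast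
    have *: "ole \<beta> \<delta>" "bt \<delta> = \<beta>" "elems (xv \<delta>) = M \<beta> \<inter> \<Omega>" using d G\<kappa>[OF \<beta>(1)] \<beta>(2) by auto
    have "M \<beta> \<prec> Hplus \<kappa>"
      unfolding M_def using p below_Hplus below_subset[OF G\<kappa>[OF \<beta>(1)]]
      by (intro skolem_hull_elem_submodel) auto
    moreover have "p \<in> M \<beta>" by (auto simp: M_def intro: skolem_hull.base)
    ultimately show ?thesis using * \<beta>(1) unfolding G_def by blast
  qed
  moreover have "\<delta> \<in> elems (bt \<delta>')" if \<delta>: "\<delta> \<in> d ` G" "\<delta>' \<in> d ` G" "\<delta> \<in> elems \<delta>'" for \<delta> \<delta>'
  proof -
    obtain \<beta> \<beta>' where \<beta>: "\<beta> \<in> G" "\<delta> = d \<beta>" "\<beta>' \<in> G" "\<delta>' = d \<beta>'" using \<delta> by blast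
    \<comment> \<open>Otherwise \<open>d \<beta>'\<close> is below \<open>\<beta>\<close>, which is
      at most \<open>d \<beta>\<close>, against the order of the two codes.\<close>
    have "\<beta>' \<notin> elems \<beta>"
    proof
      assume "\<beta>' \<in> elems \<beta>"
      then have "\<delta>' \<in> elems \<beta>" using \<beta> by (auto simp: G_def)
      moreover have "ole \<beta> \<delta>" using d G\<kappa>[OF \<beta>(1)] \<beta>(2) by blast
      moreover have "\<delta> \<in> elems \<kappa>" using d\<kappa>[OF G\<kappa>[OF \<beta>(1)]] \<beta>(2) by blast
      ultimately have "\<delta>' \<in> elems \<delta>" using ole_below_iff[OF G\<kappa>[OF \<beta>(1)], of \<delta>] by blast
      then show False using \<delta>(3) mem_asym by blast
    qed
    moreover have "\<beta> \<noteq> \<beta>'" using \<beta> \<delta>(3) mem_irrefl by blast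
    ultimately have "\<beta> \<in> elems \<beta>'"
      using below_linear[OF G\<kappa>[OF \<beta>(1)] G\<kappa>[OF \<beta>(3)]] by blast
    then have "\<delta> \<in> elems \<beta>'" using \<beta> by (auto simp: G_def)
    moreover have "bt \<delta>' = \<beta>'" using d G\<kappa>[OF \<beta>(3)] \<beta>(4) by blast
    ultimately show ?thesis by simp
  qed
  ultimately show ?thesis by (intro exI[of _ "d ` G"]) blast
qed

end

section \<open>Decoding clubs\<close>

text \<open>The predecessors of a successor have a greatest element, so no predecessor lies above
  it. Hence decoding never moves a successor ordinal.\<close>

lemma (in regular_cardinal) acc_\<kappa>_not_osucc:
  assumes "\<delta> \<in> acc (elems \<kappa>)"
  shows "\<delta> \<noteq> osucc \<gamma>"
proof
  assume eq: "\<delta> = osucc \<gamma>"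
  have \<delta>: "\<delta> \<in> elems \<kappa>" "osup (elems \<kappa> \<inter> elems \<delta>) = \<delta>" using assms by (auto simp: acc_def)
  have e: "elems \<delta> = insert \<gamma> (elems \<gamma>)" unfolding eq by (rule elems_osucc)
  have "(\<Union>a\<in>elems \<kappa> \<inter> elems \<delta>. elems a) = elems \<delta>"
    using \<delta>(2) osup_eq_iff[of "elems \<kappa> \<inter> elems \<delta>" \<delta>] by blast
  moreover have "\<gamma> \<in> elems \<delta>" using e by simp
  ultimately have "\<gamma> \<in> (\<Union>a\<in>elems \<kappa> \<inter> elems \<delta>. elems a)" by simp
  then obtain a where a: "a \<in> elems \<delta>" "\<gamma> \<in> elems a" by blast
  then have "a = \<gamma> \<or> a \<in> elems \<gamma>" using e by simp
  then show False using a(2) mem_asym[of \<gamma> a] mem_irrefl[of \<gamma>] by auto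
qed

locale ordinal_coding = regular_cardinal \<kappa> for \<kappa> :: "'k hset" +
  fixes bt xv :: "'k hset \<Rightarrow> 'k hset"
  assumes xv_H: "xv \<delta> \<in> H \<kappa>"
begin

text \<open>Accumulation points \<open>\<delta>\<close> of \<open>C\<close> never move, because \<open>osup (C \<inter> elems \<delta>) = \<delta>\<close>. Successor ordinals
  are kept fixed for the sake of the relations \<open>RightChi R \<chi>\<close>.\<close>

definition moves :: "'k hset set \<Rightarrow> 'k hset \<Rightarrow> bool" where
  "moves C \<delta> \<longleftrightarrow> \<delta> \<in> acc (elems \<kappa>) \<and> osup (C \<inter> elems \<delta>) \<in> elems (bt \<delta>) \<and> ole (bt \<delta>) \<delta>"

definition pt :: "'k hset set \<Rightarrow> 'k hset \<Rightarrow> 'k hset" where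
  "pt C \<delta> = (if moves C \<delta> then bt \<delta> else \<delta>)"

definition val :: "'k hset set \<Rightarrow> 'k hset \<Rightarrow> 'k hset" where
  "val C \<delta> = (if moves C \<delta> then xv \<delta> else ozero)"

definition decode :: "'k hset set \<Rightarrow> 'k hset \<rightharpoonup> 'k hset" where
  "decode C y = (if y \<in> pt C ` C then Some (val C (inv_into C (pt C) y)) else None)"

lemma dom_decode: "dom (decode C) = pt C ` C"
  unfolding decode_def dom_def by auto

lemma pt_le:
  assumes "\<delta> \<in> elems \<kappa>"
  shows "pt C \<delta> \<in> elems \<kappa>" "elems (pt C \<delta>) \<subseteq> elems \<delta>"
proof -
  have o: "ole (pt C \<delta>) \<delta>" unfolding pt_def moves_def ole_def by auto
  then show "pt C \<delta> \<in> elems \<kappa>" using assms below_subset[OF assms] unfolding ole_def by auto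
  then show "elems (pt C \<delta>) \<subseteq> elems \<delta>" using o ole_below_iff assms by blast
qed

lemma osup_less_pt:
  assumes "C \<subseteq> elems \<kappa>" "\<delta> \<in> elems \<kappa>" "a \<in> elems \<kappa>" "moves C \<delta>"
    "elems a \<subseteq> elems (osup (C \<inter> elems \<delta>))"
  shows "a \<in> elems (pt C \<delta>)"
proof -
  have "ole a (osup (C \<inter> elems \<delta>))"
    using ole_below_iff[OF assms(3) osup_Int_below(1)[OF assms(1,2)]] assms(5) by blast
  moreover have "osup (C \<inter> elems \<delta>) \<in> elems (pt C \<delta>)"
    using assms(4) by (simp add: moves_def pt_def)
  ultimately show ?thesis
    using below_trans[OF pt_le(1)[OF assms(2)]] unfolding ole_def by blast
qed

text \<open>A moved point stays above the supremum of the earlier points of \<open>C\<close>. As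
  points only move down, \<open>C\<close> and its decoded positions interleave; order, suprema and
  closure of the decoded set all rest on this.\<close>

lemma pt_gt:
  assumes "C \<subseteq> elems \<kappa>" "\<delta>' \<in> C" "\<delta> \<in> C" "\<delta>' \<in> elems \<delta>"
  shows "\<delta>' \<in> elems (pt C \<delta>)"
proof (cases "moves C \<delta>")
  case True
  have "elems \<delta>' \<subseteq> elems (osup (C \<inter> elems \<delta>))"
    using elems_osup[of "C \<inter> elems \<delta>"] assms by blast
  then show ?thesis using osup_less_pt[OF assms(1) _ _ True] assms by blast
qed (use assms in \<open>simp add: pt_def\<close>)

text \<open>For \<open>a\<close> before \<open>b\<close>, the decoded \<open>a\<close> is at most
  \<open>a\<close>, which is below the decoded \<open>b\<close>; linearity gives the
  converse.\<close>

lemma pt_strict_mono: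
  assumes "C \<subseteq> elems \<kappa>" "\<delta>' \<in> C" "\<delta> \<in> C"
  shows "pt C \<delta>' \<in> elems (pt C \<delta>) \<longleftrightarrow> \<delta>' \<in> elems \<delta>"
proof -
  have mono: "pt C a \<in> elems (pt C b)" if "a \<in> C" "b \<in> C" "a \<in> elems b" for a b
  proof -
    have \<kappa>: "a \<in> elems \<kappa>" "b \<in> elems \<kappa>" using that assms by auto
    have "a \<in> elems (pt C b)" using pt_gt[OF assms(1) that] .
    moreover have "ole (pt C a) a" using pt_le[OF \<kappa>(1), of C] ole_below_iff \<kappa> by blast
    ultimately show ?thesis using below_trans[OF pt_le(1)[OF \<kappa>(2), of C]] unfolding ole_def by auto
  qed
  have \<kappa>: "\<delta>' \<in> elems \<kappa>" "\<delta> \<in> elems \<kappa>" using assms by auto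
  show ?thesis
  proof
    assume l: "pt C \<delta>' \<in> elems (pt C \<delta>)"
    have "\<delta>' \<noteq> \<delta>" using l mem_irrefl by blast
    moreover have "\<delta> \<notin> elems \<delta>'" using l mono[OF assms(3,2)] mem_asym by blast
    ultimately show "\<delta>' \<in> elems \<delta>" using below_linear[OF \<kappa>] by blast
  qed (use mono assms in blast)
qed

lemma inj_on_pt: "C \<subseteq> elems \<kappa> \<Longrightarrow> inj_on (pt C) C"
proof (rule inj_onI)
  fix a b assume C: "C \<subseteq> elems \<kappa>" and ab: "a \<in> C" "b \<in> C" "pt C a = pt C b"
  have "a \<notin> elems b" "b \<notin> elems a"
    using pt_strict_mono[OF C ab(1,2)] pt_strict_mono[OF C ab(2,1)] ab(3) mem_irrefl by auto
  then show "a = b" using below_linear[of a b] C ab by blast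
qed

text \<open>\<open>pt C\<close> is injective on \<open>C\<close>, so the inverse inside
  \<open>decode\<close> recovers the original point.\<close>

lemma decode_eq_Some_iff:
  assumes "C \<subseteq> elems \<kappa>"
  shows "decode C y = Some v \<longleftrightarrow> (\<exists>\<delta>\<in>C. pt C \<delta> = y \<and> val C \<delta> = v)"
  unfolding decode_def using inv_into_f_f[OF inj_on_pt[OF assms]] inj_on_pt[OF assms]
  by (auto simp: inj_on_def) metis

lemma pt_image_subset: "C \<subseteq> elems \<kappa> \<Longrightarrow> pt C ` C \<subseteq> elems \<kappa>"
  using pt_le(1) by blast

lemma otp_dom_decode: "C \<subseteq> elems \<kappa> \<Longrightarrow> otp (dom (decode C)) = otp C"
  unfolding dom_decode
  by (rule otp_image) (auto intro: Ord_below card_subset_\<kappa> inj_on_pt simp: pt_strict_mono)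

text \<open>By interleaving, a limit of decoded positions is a limit of points of
  \<open>C\<close>.\<close>

lemma osup_pt_Int:
  assumes C: "C \<subseteq> elems \<kappa>" and \<beta>: "\<beta> \<in> elems \<kappa>" and s: "osup (pt C ` C \<inter> elems \<beta>) = \<beta>"
  shows "osup (C \<inter> elems \<beta>) = \<beta>"
proof -
  have u: "(\<Union>a\<in>pt C ` C \<inter> elems \<beta>. elems a) = elems \<beta>"
    using s osup_eq_iff[of "pt C ` C \<inter> elems \<beta>" \<beta>] pt_image_subset[OF C] by blast
  have "(\<Union>a\<in>C \<inter> elems \<beta>. elems a) = elems \<beta>"
  proof (intro equalityI subsetI)
    fix x assume "x \<in> (\<Union>a\<in>C \<inter> elems \<beta>. elems a)"
    then show "x \<in> elems \<beta>" using below_trans[OF \<beta>] by blast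
  next
    fix x assume "x \<in> elems \<beta>"
    then have "x \<in> (\<Union>a\<in>pt C ` C \<inter> elems \<beta>. elems a)" using u by simp
    then obtain \<delta> where \<delta>: "\<delta> \<in> C" "pt C \<delta> \<in> elems \<beta>" "x \<in> elems (pt C \<delta>)" by blast
    \<comment> \<open>From its decoded position alone, \<open>\<delta>\<close> might be as large as
      \<open>\<beta>\<close>. A later decoded position below \<open>\<beta>\<close> lies above
      \<open>\<delta>\<close> and rules this out.\<close>
    then have "pt C \<delta> \<in> (\<Union>a\<in>pt C ` C \<inter> elems \<beta>. elems a)" using u by simp
    then obtain \<delta>2 where \<delta>2: "\<delta>2 \<in> C" "pt C \<delta>2 \<in> elems \<beta>" "pt C \<delta> \<in> elems (pt C \<delta>2)" by blast
    then have "\<delta> \<in> elems \<delta>2" using pt_strict_mono[OF C \<delta>(1) \<delta>2(1)] by blast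
    then have "\<delta> \<in> elems (pt C \<delta>2)" using pt_gt[OF C \<delta>(1) \<delta>2(1)] by blast
    then have "\<delta> \<in> elems \<beta>" using below_trans[OF \<beta>] \<delta>2(2) by blast
    moreover have "x \<in> elems \<delta>" using \<delta> pt_le(2)[of \<delta> C] C by blast
    ultimately show "x \<in> (\<Union>a\<in>C \<inter> elems \<beta>. elems a)" using \<delta>(1) by blast
  qed
  then show ?thesis using osup_eq_iff[of "C \<inter> elems \<beta>" \<beta>] C by blast
qed

text \<open>A move would need \<open>\<beta>\<close> to be below \<open>bt \<beta>\<close> and
  \<open>bt \<beta>\<close> to be at most \<open>\<beta>\<close>.\<close>

lemma not_moves_limit: "osup (C \<inter> elems \<beta>) = \<beta> \<Longrightarrow> \<not> moves C \<beta>"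
  unfolding moves_def ole_def using mem_asym mem_irrefl by metis

section \<open>Decoded clubs are clubs with the same supremum\<close>

lemma KK_D:
  assumes "C \<in> KK \<kappa>"
  shows "C \<subseteq> elems \<kappa>" "C \<noteq> {}" "C \<subseteq> elems (osup C)" "elems (osup C) = (\<Union>a\<in>C. elems a)"
    "elems (osup C) \<subseteq> elems \<kappa>"
    "\<And>\<beta>. \<beta> \<in> elems (osup C) \<Longrightarrow> ozero \<in> elems \<beta> \<Longrightarrow> osup (C \<inter> elems \<beta>) = \<beta> \<Longrightarrow> \<beta> \<in> C"
proof -
  show C: "C \<subseteq> elems \<kappa>" "C \<noteq> {}" "C \<subseteq> elems (osup C)"
    "\<And>\<beta>. \<beta> \<in> elems (osup C) \<Longrightarrow> ozero \<in> elems \<beta> \<Longrightarrow> osup (C \<inter> elems \<beta>) = \<beta> \<Longrightarrow> \<beta> \<in> C"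
    using assms by (auto simp: KK_def club_in_def cofinal_in_def)
  show e: "elems (osup C) = (\<Union>a\<in>C. elems a)" using elems_osup[OF C(1)] .
  show "elems (osup C) \<subseteq> elems \<kappa>" unfolding e using C(1) below_subset by blast
qed

lemma KK_above: "C \<in> KK \<kappa> \<Longrightarrow> \<delta> \<in> C \<Longrightarrow> \<exists>\<delta>'\<in>C. \<delta> \<in> elems \<delta>'"
  using KK_D(3,4)[of C] by blast

text \<open>Decoding only lowers points, and each point of \<open>C\<close> is exceeded by the
  decoded position of any later point.\<close>

lemma osup_dom_decode:
  assumes "C \<in> KK \<kappa>"
  shows "osup (dom (decode C)) = osup C"
proof -
  note C = KK_D[OF assms]
  have "(\<Union>a\<in>pt C ` C. elems a) = (\<Union>a\<in>C. elems a)"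
  proof (intro equalityI subsetI)
    fix x assume "x \<in> (\<Union>a\<in>pt C ` C. elems a)"
    then obtain \<delta> where "\<delta> \<in> C" "x \<in> elems (pt C \<delta>)" by blast
    then show "x \<in> (\<Union>a\<in>C. elems a)" using pt_le(2)[of \<delta> C] C(1) by blast
  next
    fix x assume "x \<in> (\<Union>a\<in>C. elems a)"
    then obtain \<delta> where \<delta>: "\<delta> \<in> C" "x \<in> elems \<delta>" by blast
    obtain \<delta>' where \<delta>': "\<delta>' \<in> C" "\<delta> \<in> elems \<delta>'" using KK_above[OF assms \<delta>(1)] by blast
    have "\<delta> \<in> elems (pt C \<delta>')" using pt_gt[OF C(1) \<delta>(1) \<delta>'] .
    then have "x \<in> elems (pt C \<delta>')" using below_trans[of "pt C \<delta>'"] pt_le(1) \<delta> \<delta>' C(1) by blast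
    then show "x \<in> (\<Union>a\<in>pt C ` C. elems a)" using \<delta>'(1) by blast
  qed
  then show ?thesis
    unfolding dom_decode using osup_eq_iff[OF pt_image_subset[OF C(1)]] C(4) by simp
qed

text \<open>For closure, a limit of the decoded set is a limit of \<open>C\<close> by
  \<open>osup_pt_Int\<close>; it therefore belongs to \<open>C\<close> and stays in place.\<close>

lemma dom_decode_KK:
  assumes "C \<in> KK \<kappa>"
  shows "dom (decode C) \<in> KK \<kappa>"
proof -
  note C = KK_D[OF assms]
  note os = osup_dom_decode[OF assms, unfolded dom_decode]
  have below: "pt C ` C \<subseteq> elems (osup C)"
  proof
    fix y assume "y \<in> pt C ` C"
    then obtain \<delta> where \<delta>: "\<delta> \<in> C" "y = pt C \<delta>" by blast
    obtain \<delta>' where \<delta>': "\<delta>' \<in> C" "\<delta> \<in> elems \<delta>'" using KK_above[OF assms \<delta>(1)] by blast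
    then have "y \<in> elems (pt C \<delta>')" using pt_strict_mono[OF C(1) \<delta>(1) \<delta>'(1)] \<delta>(2) by blast
    then have "y \<in> elems \<delta>'" using pt_le(2)[of \<delta>' C] \<delta>'(1) C(1) by blast
    then show "y \<in> elems (osup C)" unfolding C(4) using \<delta>'(1) by blast
  qed
  have "\<beta> \<in> pt C ` C" if "\<beta> \<in> elems (osup C)" "ozero \<in> elems \<beta>" "osup (pt C ` C \<inter> elems \<beta>) = \<beta>" for \<beta>
  proof -
    have "osup (C \<inter> elems \<beta>) = \<beta>" using osup_pt_Int[OF C(1) _ that(3)] that(1) C(5) by blast
    then have "\<beta> \<in> C" "pt C \<beta> = \<beta>"
      using C(6)[OF that(1,2)] not_moves_limit[of C \<beta>] by (auto simp: pt_def)
    then show ?thesis by (metis imageI)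
  qed
  then show ?thesis
    unfolding KK_def dom_decode club_in_def cofinal_in_def
    using below os pt_image_subset[OF C(1)] C(2) mem_irrefl by auto
qed

lemma decode_FF: "C \<in> KK \<kappa> \<Longrightarrow> decode C \<in> FF \<kappa>"
  unfolding FF_def using dom_decode_KK xv_H ozero_H
  by (auto simp: decode_eq_Some_iff[OF KK_D(1)] ran_def val_def)

text \<open>Coherence of the decoded club thus has to be checked only at accumulation points of the
  original one.\<close>

lemma acc_dom_decode:
  assumes "C \<in> KK \<kappa>" "a \<in> acc (dom (decode C))"
  shows "a \<in> acc C"
proof -
  have a: "a \<in> dom (decode C)" "osup (dom (decode C) \<inter> elems a) = a" "ozero \<in> elems a"
    using assms(2) by (auto simp: acc_def)
  have "a \<in> elems (osup C)"
    using KK_D(3)[OF dom_decode_KK[OF assms(1)]] a(1) osup_dom_decode[OF assms(1)] by auto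
  moreover from this have "osup (C \<inter> elems a) = a"
    using osup_pt_Int[OF KK_D(1)[OF assms(1)], of a] a(2) KK_D(5)[OF assms(1)] unfolding dom_decode by blast
  ultimately show ?thesis using KK_D(6)[OF assms(1)] a(3) by (auto simp: acc_def)
qed

section \<open>Preservation of the coherence relations\<close>

text \<open>No point drops into an initial segment from outside: if \<open>\<delta>\<close> were not
  below the supremum of \<open>E\<close>, then \<open>E\<close> would be part of \<open>C\<close>
  below \<open>\<delta>\<close>, and a move keeps \<open>\<delta>\<close> above the supremum of that
  part.\<close>

lemma pt_reflects_below:
  assumes C: "C \<subseteq> elems \<kappa>" and E: "E \<subseteq> C" "E \<subseteq> elems (osup E)"
    and \<delta>: "\<delta> \<in> C" "pt C \<delta> \<in> elems (osup E)"
  shows "\<delta> \<in> elems (osup E)"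
proof (rule ccontr)
  assume n: "\<delta> \<notin> elems (osup E)"
  have m: "moves C \<delta>" using n \<delta>(2) by (auto simp: pt_def split: if_splits)
  have \<delta>\<kappa>: "\<delta> \<in> elems \<kappa>" using \<delta>(1) C by blast
  have oE: "elems (osup E) = (\<Union>a\<in>E. elems a)" using elems_osup[of E] C E by blast
  have "d \<in> elems \<delta>" if "d \<in> E" for d
  proof -
    have "d \<in> elems \<kappa>" "\<delta> \<notin> elems d" using that n E C oE by blast+
    moreover have "d \<noteq> \<delta>" using that n E(2) by blast
    ultimately show ?thesis using below_linear[OF _ \<delta>\<kappa>] by blast
  qed
  then have "E \<subseteq> C \<inter> elems \<delta>" using E by blast
  then have "elems (osup E) \<subseteq> elems (osup (C \<inter> elems \<delta>))"
    unfolding oE using elems_osup[of "C \<inter> elems \<delta>"] C by blast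
  then have "pt C \<delta> \<in> elems (osup (C \<inter> elems \<delta>))" using \<delta>(2) by blast
  moreover have "osup (C \<inter> elems \<delta>) \<in> elems (pt C \<delta>)" using m by (simp add: moves_def pt_def)
  ultimately show False using mem_asym by blast
qed

text \<open>Below a point of \<open>D\<close> the two clubs coincide, hence so do the moves.
  Conversely, decoded points of \<open>C\<close> below the supremum of \<open>D\<close> come from
  \<open>D\<close> by \<open>pt_reflects_below\<close>.\<close>

lemma sq_decode:
  assumes D: "D \<in> KK \<kappa>" and C: "C \<in> KK \<kappa>" and sq: "sqK D C"
  shows "sqF (decode D) (decode C)"
proof -
  let ?a = "osup D"
  note D' = KK_D[OF D] and C' = KK_D[OF C]
  have DC: "D = C \<inter> elems ?a" using sq by (simp add: sqK_def)
  have same: "moves D \<delta> \<longleftrightarrow> moves C \<delta>" if \<delta>: "\<delta> \<in> D" for \<delta>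
  proof -
    have "\<delta> \<in> elems ?a" using DC \<delta> by blast
    then have "elems \<delta> \<subseteq> elems ?a" unfolding D'(4) using below_trans D'(1) by blast
    then have "D \<inter> elems \<delta> = C \<inter> elems \<delta>" using DC by blast
    then show ?thesis unfolding moves_def by simp
  qed
  have in_D: "\<delta> \<in> D" if "\<delta> \<in> C" "pt C \<delta> \<in> elems ?a" for \<delta>
    using pt_reflects_below[OF C'(1) _ D'(3) that] DC that(1) by blast
  have "decode D y = (decode C |` elems ?a) y" for y
  proof -
    have "decode D y = Some v \<longleftrightarrow> (decode C |` elems ?a) y = Some v" for v
    proof
      assume "decode D y = Some v"
      then obtain \<delta> where \<delta>: "\<delta> \<in> D" "pt D \<delta> = y" "val D \<delta> = v"
        using decode_eq_Some_iff[OF D'(1)] by blast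
      have "y \<in> elems ?a"
        using KK_D(3)[OF dom_decode_KK[OF D]] osup_dom_decode[OF D] \<delta> unfolding dom_decode by auto
      moreover have "pt C \<delta> = y" "val C \<delta> = v" "\<delta> \<in> C"
        using \<delta> same[OF \<delta>(1)] DC by (auto simp: pt_def val_def)
      ultimately show "(decode C |` elems ?a) y = Some v"
        using decode_eq_Some_iff[OF C'(1)] by (auto simp: restrict_map_def)
    next
      assume "(decode C |` elems ?a) y = Some v"
      then have "y \<in> elems ?a" "decode C y = Some v" by (auto simp: restrict_map_def split: if_splits)
      then obtain \<delta> where \<delta>: "\<delta> \<in> C" "pt C \<delta> = y" "val C \<delta> = v" "y \<in> elems ?a"
        using decode_eq_Some_iff[OF C'(1)] by blast
      then have d: "\<delta> \<in> D" using in_D by blast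
      then have "pt D \<delta> = y" "val D \<delta> = v" using \<delta> same[OF d] by (auto simp: pt_def val_def)
      then show "decode D y = Some v" using decode_eq_Some_iff[OF D'(1)] d by blast
    qed
    then show ?thesis by (metis not_Some_eq)
  qed
  then show ?thesis unfolding sqF_def osup_dom_decode[OF D] by blast
qed

lemma osup_Diff:
  assumes D: "D \<in> KK \<kappa>" and \<gamma>: "\<gamma> \<in> elems (osup D)"
  shows "osup (D - elems \<gamma>) = osup D"
proof -
  note D' = KK_D[OF D]
  have sub: "D - elems \<gamma> \<subseteq> elems \<kappa>" using D'(1) by blast
  obtain d' where d': "d' \<in> D" "\<gamma> \<in> elems d'" using \<gamma> unfolding D'(4) by blast
  have "(\<Union>a\<in>D - elems \<gamma>. elems a) = (\<Union>a\<in>D. elems a)"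
  proof (intro equalityI subsetI)
    fix x assume "x \<in> (\<Union>a\<in>D. elems a)"
    then obtain d where d: "d \<in> D" "x \<in> elems d" by blast
    show "x \<in> (\<Union>a\<in>D - elems \<gamma>. elems a)"
    proof (cases "d \<in> elems \<gamma>")
      case True
      have "d' \<in> elems \<kappa>" using d'(1) D'(1) by blast
      then have "x \<in> elems d'" using below_trans d(2) d'(2) True by blast
      moreover have "d' \<notin> elems \<gamma>" using d'(2) mem_asym by blast
      ultimately show ?thesis using d'(1) by blast
    qed (use d in blast)
  qed blast
  then show ?thesis using osup_eq_iff[OF sub] D'(4) by simp
qed

lemma sq_star_decode:
  assumes D: "D \<in> KK \<kappa>" and C: "C \<in> KK \<kappa>" and sq: "sqK_star D C"
  shows "sqF_star (decode D) (decode C)"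
proof -
  let ?a = "osup D"
  note D' = KK_D[OF D] and C' = KK_D[OF C]
  obtain \<gamma> where \<gamma>: "\<gamma> \<in> elems ?a" and sq\<gamma>: "sqK (D - elems \<gamma>) (C - elems \<gamma>)"
    using sq by (auto simp: sqK_star_def)
  have eq: "D - elems \<gamma> = (C - elems \<gamma>) \<inter> elems ?a"
    using sq\<gamma> unfolding sqK_def osup_Diff[OF D \<gamma>] .
  then have DC: "c \<in> D \<longleftrightarrow> c \<in> C \<and> c \<in> elems ?a" if "c \<notin> elems \<gamma>" for c
    using that by blast
  have a_trans: "x \<in> elems ?a" if "x \<in> elems c" "c \<in> elems ?a" for x c
    using that D'(1) below_trans unfolding D'(4) by blast
  \<comment> \<open>\<open>\<gamma>1\<close> is common to both clubs and exceeds all their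
    disagreements below \<open>\<gamma>\<close>; every point from \<open>\<gamma>2\<close> on lies
    strictly beyond \<open>\<gamma>1\<close>.\<close>
  obtain \<gamma>1 where \<gamma>1: "\<gamma>1 \<in> D" "\<gamma> \<in> elems \<gamma>1" using \<gamma> unfolding D'(4) by blast
  obtain \<gamma>2 where \<gamma>2: "\<gamma>2 \<in> D" "\<gamma>1 \<in> elems \<gamma>2" using KK_above[OF D \<gamma>1(1)] by blast
  have \<gamma>1\<kappa>: "\<gamma>1 \<in> elems \<kappa>" and \<gamma>2\<kappa>: "\<gamma>2 \<in> elems \<kappa>" using \<gamma>1 \<gamma>2 D'(1) by blast+
  have n1: "\<gamma>1 \<notin> elems \<gamma>" using \<gamma>1(2) mem_asym by blast
  have late: "\<delta> \<notin> elems \<gamma>" if "\<gamma>1 \<in> elems \<delta>" for \<delta>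
    using \<gamma>1(2) that below_trans[OF \<gamma>1\<kappa>, of \<delta> \<gamma>] mem_asym by blast
  have C1: "\<gamma>1 \<in> C" using DC[OF n1] \<gamma>1(1) by blast
  have C2: "\<gamma>2 \<in> C" using DC[OF late[OF \<gamma>2(2)]] \<gamma>2(1) by blast
  \<comment> \<open>The clubs may differ below \<open>\<gamma>\<close>, but the common point
    \<open>\<gamma>1\<close> makes the suprema below \<open>\<delta>\<close> equal, and the move at
    \<open>\<delta>\<close> sees nothing else of the club.\<close>
  have same: "moves D \<delta> \<longleftrightarrow> moves C \<delta>" if \<delta>: "\<delta> \<in> D" "\<gamma>1 \<in> elems \<delta>" for \<delta>
  proof -
    have early: "x \<in> elems \<gamma>1" if "x \<in> elems c" "c \<in> elems \<gamma>" for x c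
      using that \<gamma>1(2) below_trans[OF \<gamma>1\<kappa>] by blast
    have \<delta>a: "\<delta> \<in> elems ?a" using \<delta>(1) D'(3) by blast
    have "(\<Union>c\<in>D \<inter> elems \<delta>. elems c) = (\<Union>c\<in>C \<inter> elems \<delta>. elems c)"
    proof (intro equalityI subsetI)
      fix x assume "x \<in> (\<Union>c\<in>D \<inter> elems \<delta>. elems c)"
      then obtain c where c: "c \<in> D" "c \<in> elems \<delta>" "x \<in> elems c" by blast
      then show "x \<in> (\<Union>c\<in>C \<inter> elems \<delta>. elems c)"
        using DC[of c] early[of x c] C1 \<delta>(2) by (cases "c \<in> elems \<gamma>") auto
    next
      fix x assume "x \<in> (\<Union>c\<in>C \<inter> elems \<delta>. elems c)"
      then obtain c where c: "c \<in> C" "c \<in> elems \<delta>" "x \<in> elems c" by blast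
      then show "x \<in> (\<Union>c\<in>D \<inter> elems \<delta>. elems c)"
        using DC[of c] early[of x c] \<gamma>1(1) \<delta>(2) a_trans[OF c(2) \<delta>a] by (cases "c \<in> elems \<gamma>") auto
    qed
    then have "osup (D \<inter> elems \<delta>) = osup (C \<inter> elems \<delta>)" unfolding osup_def by simp
    then show ?thesis unfolding moves_def by simp
  qed
  have after: "\<gamma>1 \<in> elems \<delta>" if "\<delta> \<in> elems \<kappa>" "\<delta> \<notin> elems \<gamma>2" for \<delta>
    using below_linear[OF that(1) \<gamma>2\<kappa>] that \<gamma>2(2) below_trans[OF that(1)] by blast
  \<comment> \<open>The decoded sets are cut at the decoded position of \<open>\<gamma>2\<close>; by
    monotonicity what remains comes from points not below \<open>\<gamma>2\<close>.\<close>
  define \<gamma>' where "\<gamma>' = pt D \<gamma>2"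
  have \<gamma>'C: "\<gamma>' = pt C \<gamma>2" using same[OF \<gamma>2] by (simp add: \<gamma>'_def pt_def)
  have dom_below: "pt D ` D \<subseteq> elems ?a"
    using KK_D(3)[OF dom_decode_KK[OF D]] osup_dom_decode[OF D] by (simp add: dom_decode)
  have \<gamma>'a: "\<gamma>' \<in> elems ?a" unfolding \<gamma>'_def using dom_below \<gamma>2(1) by blast
  let ?D = "decode D |` (dom (decode D) - elems \<gamma>')" and ?C = "decode C |` (dom (decode C) - elems \<gamma>')"
  have "dom ?D = dom (decode D) - elems \<gamma>'" by auto
  then have osupD: "osup (dom ?D) = ?a"
    using osup_Diff[OF dom_decode_KK[OF D], unfolded osup_dom_decode[OF D], OF \<gamma>'a] by simp
  have r: "?D y = Some v \<longleftrightarrow> decode D y = Some v \<and> y \<notin> elems \<gamma>'"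
       "?C y = Some v \<longleftrightarrow> decode C y = Some v \<and> y \<notin> elems \<gamma>'" for y v
    by (auto simp: restrict_map_def dom_def)
  have "?D y = Some v \<longleftrightarrow> (?C |` elems ?a) y = Some v" for y v
  proof -
    have "(?C |` elems ?a) y = Some v \<longleftrightarrow> y \<in> elems ?a \<and> decode C y = Some v \<and> y \<notin> elems \<gamma>'"
      unfolding r(2)[symmetric] by (simp add: restrict_map_def)
    moreover have "decode D y = Some v \<and> y \<notin> elems \<gamma>' \<longleftrightarrow>
        y \<in> elems ?a \<and> decode C y = Some v \<and> y \<notin> elems \<gamma>'"
    proof
      assume l: "decode D y = Some v \<and> y \<notin> elems \<gamma>'"
      then obtain \<delta> where \<delta>: "\<delta> \<in> D" "pt D \<delta> = y" "val D \<delta> = v"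
        using decode_eq_Some_iff[OF D'(1)] by blast
      have "\<delta> \<notin> elems \<gamma>2" using l \<delta> pt_strict_mono[OF D'(1) \<delta>(1) \<gamma>2(1)] by (simp add: \<gamma>'_def)
      then have g: "\<gamma>1 \<in> elems \<delta>" using after \<delta>(1) D'(1) by blast
      then have "\<delta> \<in> C" using DC[OF late[OF g]] \<delta>(1) by blast
      moreover have "pt C \<delta> = y" "val C \<delta> = v"
        using \<delta> same[OF \<delta>(1) g] by (auto simp: pt_def val_def)
      ultimately have "decode C y = Some v" using decode_eq_Some_iff[OF C'(1)] by blast
      then show "y \<in> elems ?a \<and> decode C y = Some v \<and> y \<notin> elems \<gamma>'"
        using l dom_below \<delta> by blast
    next
      assume l: "y \<in> elems ?a \<and> decode C y = Some v \<and> y \<notin> elems \<gamma>'"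
      then obtain \<delta> where \<delta>: "\<delta> \<in> C" "pt C \<delta> = y" "val C \<delta> = v"
        using decode_eq_Some_iff[OF C'(1)] by blast
      have "\<delta> \<notin> elems \<gamma>2" using l \<delta> pt_strict_mono[OF C'(1) \<delta>(1) C2] by (simp add: \<gamma>'C)
      then have g: "\<gamma>1 \<in> elems \<delta>" using after \<delta>(1) C'(1) by blast
      \<comment> \<open>The reflection lemma is applied to the tail of \<open>D\<close>, which is
        contained in \<open>C\<close>, unlike possibly \<open>D\<close> itself.\<close>
      have "\<delta> \<in> elems (osup (D - elems \<gamma>))"
      proof (rule pt_reflects_below[OF C'(1)])
        show "D - elems \<gamma> \<subseteq> C" using eq by blast
        show "D - elems \<gamma> \<subseteq> elems (osup (D - elems \<gamma>))" unfolding osup_Diff[OF D \<gamma>] using D'(3) by blast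
        show "pt C \<delta> \<in> elems (osup (D - elems \<gamma>))" unfolding osup_Diff[OF D \<gamma>] using l \<delta> by blast
      qed (rule \<delta>(1))
      then have "\<delta> \<in> D" using DC[OF late[OF g]] \<delta>(1) unfolding osup_Diff[OF D \<gamma>] by blast
      moreover from this have "pt D \<delta> = y" "val D \<delta> = v"
        using \<delta> same[OF _ g] by (auto simp: pt_def val_def)
      ultimately have "decode D y = Some v" using decode_eq_Some_iff[OF D'(1)] by blast
      then show "decode D y = Some v \<and> y \<notin> elems \<gamma>'" using l by blast
    qed
    ultimately show ?thesis unfolding r(1) by blast
  qed
  then have "?D y = (?C |` elems ?a) y" for y by (metis not_Some_eq)
  then have "sqF ?D ?C" unfolding sqF_def osupD by blast
  then show ?thesis unfolding sqF_star_def osup_dom_decode[OF D] using \<gamma>'a by blast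
qed

text \<open>Accumulation points never move, and neither do successors. This carries over the side
  condition of \<open>RightChi\<close>.\<close>

lemma dom_decode_successors:
  assumes "\<forall>\<beta>\<in>nacc C. \<exists>\<gamma>. Ord \<gamma> \<and> \<beta> = osucc \<gamma>"
  shows "dom (decode C) = C"
proof -
  have "pt C \<delta> = \<delta>" if \<delta>: "\<delta> \<in> C" for \<delta>
  proof (rule ccontr)
    assume "pt C \<delta> \<noteq> \<delta>"
    then have m: "moves C \<delta>" by (auto simp: pt_def split: if_splits)
    then have "\<delta> \<notin> acc C" using not_moves_limit[of C \<delta>] by (auto simp: acc_def)
    then obtain \<gamma> where "\<delta> = osucc \<gamma>" using \<delta> assms by (auto simp: nacc_def)
    then show False using m acc_\<kappa>_not_osucc unfolding moves_def by blast
  qed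
  then show ?thesis unfolding dom_decode by simp
qed

text \<open>The cofinality clause sees only the supremum, which decoding keeps; under the clause on
  order type and successors the underlying club itself is unchanged.\<close>

lemma chi_decode:
  assumes "D \<in> KK \<kappa>" "C \<in> KK \<kappa>" "chi_interp sqK sqK_star (\<lambda>C. C) R D C"
  shows "chi_interp sqF sqF_star dom R (decode D) (decode C)"
proof -
  have sq: "sq_interp sqK sqK_star r D C \<Longrightarrow> sq_interp sqF sqF_star r (decode D) (decode C)" for r
    using sq_decode[OF assms(1,2)] sq_star_decode[OF assms(1,2)] by (cases r) auto
  show ?thesis
  proof (cases R)
    case (RightChi r \<chi>)
    then show ?thesis using assms(3) sq[of r] dom_decode_successors[of C] by auto
  qed (use assms(3) sq osup_dom_decode[OF assms(1)] in auto)
qed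

lemma rel_decode:
  assumes "D \<in> KK \<kappa>" "C \<in> KK \<kappa>" "relK R D C"
  shows "relF R (decode D) (decode C)"
  using assms chi_decode[OF assms(1,2)] osup_dom_decode[OF assms(1)]
  unfolding relK_def relF_def by (cases R) auto

text \<open>Among the first \<open>Suc n\<close> successors of \<open>\<gamma>\<close> in \<open>C\<close>, each one but the first has its predecessor
  in \<open>A\<close> too, so sparseness of \<open>A\<close> puts its decoded point above that predecessor.\<close>

lemma succ_n_decode:
  assumes C: "C \<in> KK \<kappa>" and \<gamma>: "\<gamma> \<in> C" and sub: "succ_n (Suc n) (C - elems \<gamma>) \<subseteq> A"
    and A: "A \<subseteq> acc (elems \<kappa>)" "\<And>\<delta>. \<delta> \<in> A \<Longrightarrow> ole (bt \<delta>) \<delta>"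
    and sparse: "\<And>\<delta> \<delta>'. \<delta> \<in> A \<Longrightarrow> \<delta>' \<in> A \<Longrightarrow> \<delta> \<in> elems \<delta>' \<Longrightarrow> \<delta> \<in> elems (bt \<delta>')"
  shows "\<exists>y\<in>dom (decode C). \<gamma> \<in> elems y \<and>
    (\<forall>z\<in>succ_n n (dom (decode C) - elems y). \<exists>\<delta>\<in>A \<inter> C. z = bt \<delta> \<and> decode C z = Some (xv \<delta>))"
proof -
  note C' = KK_D[OF C]
  have \<kappa>: "c \<in> elems \<kappa>" if "c \<in> C" for c using that C'(1) by blast
  obtain d where "d \<in> {\<delta> \<in> C. \<gamma> \<in> elems \<delta>}" using KK_above[OF C \<gamma>] by blast
  \<comment> \<open>The next point of \<open>C\<close> after \<open>\<gamma>\<close>; its decoded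
    position will be \<open>y\<close>. Its predecessor \<open>\<gamma>\<close> need not be in
    \<open>A\<close>, so no move is claimed for it, at the cost of one successor.\<close>
  then obtain \<gamma>' where "\<gamma>' \<in> {\<delta> \<in> C. \<gamma> \<in> elems \<delta>}"
    and "\<And>y. (y, \<gamma>') \<in> mem \<Longrightarrow> y \<notin> {\<delta> \<in> C. \<gamma> \<in> elems \<delta>}"
    using wfE_min[OF wf_mem, of d "{\<delta> \<in> C. \<gamma> \<in> elems \<delta>}"] by blast
  then have \<gamma>': "\<gamma>' \<in> C" "\<gamma> \<in> elems \<gamma>'" and least: "\<And>\<delta>. \<delta> \<in> C \<Longrightarrow> \<gamma> \<in> elems \<delta> \<Longrightarrow> \<delta> \<notin> elems \<gamma>'"
    by (auto simp: mem_def)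
  let ?y = "pt C \<gamma>'"
  have tail: "dom (decode C) - elems ?y = pt C ` (C - elems \<gamma>')"
    unfolding dom_decode using pt_strict_mono[OF C'(1) _ \<gamma>'(1)] by auto
  have "\<exists>\<delta>\<in>A \<inter> C. z = bt \<delta> \<and> decode C z = Some (xv \<delta>)"
    if z: "z \<in> succ_n n (dom (decode C) - elems ?y)" for z
  proof -
    have tail\<kappa>: "pt C ` (C - elems \<gamma>') \<subseteq> elems \<kappa>" using pt_image_subset[OF C'(1)] by blast
    obtain \<delta> where \<delta>: "\<delta> \<in> C" "\<delta> \<notin> elems \<gamma>'" "z = pt C \<delta>"
      and fin: "finite (pt C ` (C - elems \<gamma>') \<inter> elems z)"
        "1 \<le> card (pt C ` (C - elems \<gamma>') \<inter> elems z)" "card (pt C ` (C - elems \<gamma>') \<inter> elems z) \<le> n"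
      using z unfolding tail succ_n_eq[OF tail\<kappa>] by auto
    \<comment> \<open>The points of \<open>C\<close> from \<open>\<gamma>'\<close> up to
      \<open>\<delta>\<close>. As \<open>pt C\<close> is injective and monotone, their number is
      that of the predecessors of \<open>z\<close> in the decoded tail, hence at most
      \<open>n\<close>.\<close>
    define K where "K = (C - elems \<gamma>') \<inter> elems \<delta>"
    have KC: "K \<subseteq> C" by (auto simp: K_def)
    have img: "pt C ` (C - elems \<gamma>') \<inter> elems z = pt C ` K"
      unfolding K_def \<delta>(3) using pt_strict_mono[OF C'(1) _ \<delta>(1)] by auto
    have inj: "inj_on (pt C) K" using inj_on_pt[OF C'(1)] KC by (rule inj_on_subset)
    have K: "finite K" "1 \<le> card K" "card K \<le> n"
      using fin finite_imageD[OF _ inj] card_image[OF inj] unfolding img by auto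
    \<comment> \<open>The maximum of \<open>K\<close> is the immediate predecessor of
      \<open>\<delta>\<close> in \<open>C\<close>.\<close>
    then have "K \<noteq> {}" by auto
    moreover have "K \<subseteq> elems \<kappa>" using KC C'(1) by blast
    ultimately obtain m where m: "m \<in> K" "K - {m} \<subseteq> elems m" using finite_has_max[OF K(1)] by blast
    have mC: "m \<in> C" "m \<in> elems \<delta>" "m \<notin> elems \<gamma>'" using m(1) by (auto simp: K_def)
    have \<gamma>m: "\<gamma> \<in> elems m"
      using below_linear[OF \<kappa>[OF mC(1)] \<kappa>[OF \<gamma>'(1)]] mC(3) \<gamma>'(2) below_trans[OF \<kappa>[OF mC(1)]] by blast
    have \<gamma>\<delta>: "\<gamma> \<in> elems \<delta>" using \<gamma>m mC(2) below_trans[OF \<kappa>[OF \<delta>(1)]] by blast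
    \<comment> \<open>Counting from \<open>\<gamma>\<close> instead of \<open>\<gamma>'\<close> adds
      just \<open>\<gamma>\<close>, so both \<open>\<delta>\<close> and its predecessor
      \<open>m\<close> are among the first \<open>Suc n\<close> successors of
      \<open>\<gamma>\<close>.\<close>
    have ins: "(C - elems \<gamma>) \<inter> elems \<delta> = insert \<gamma> K"
    proof (intro equalityI subsetI)
      fix x assume x: "x \<in> (C - elems \<gamma>) \<inter> elems \<delta>"
      then have "x = \<gamma> \<or> \<gamma> \<in> elems x" using below_linear[OF \<kappa> \<kappa>[OF \<gamma>], of x] by blast
      then show "x \<in> insert \<gamma> K" using x least[of x] by (auto simp: K_def)
    next
      fix x assume x: "x \<in> insert \<gamma> K"
      have "x \<notin> elems \<gamma>"
      proof
        assume x\<gamma>: "x \<in> elems \<gamma>"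
        then have "x \<in> elems \<gamma>'" using \<gamma>'(2) below_trans[OF \<kappa>[OF \<gamma>'(1)]] by blast
        moreover have "x \<noteq> \<gamma>" using x\<gamma> mem_irrefl by blast
        ultimately show False using x by (auto simp: K_def)
      qed
      then show "x \<in> (C - elems \<gamma>) \<inter> elems \<delta>" using x \<gamma> \<gamma>\<delta> by (auto simp: K_def)
    qed
    have sub\<kappa>: "C - elems \<gamma> \<subseteq> elems \<kappa>" using C'(1) by blast
    have cardI: "finite (insert \<gamma> K)" "card (insert \<gamma> K) \<le> Suc n"
      using K by (auto simp: card_insert_if)
    have in_A: "x \<in> A" if x: "x \<in> C" "\<gamma> \<in> elems x" "elems x \<subseteq> elems \<delta>" for x
    proof -
      have s: "(C - elems \<gamma>) \<inter> elems x \<subseteq> insert \<gamma> K" using x(3) ins by blast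
      have f: "finite ((C - elems \<gamma>) \<inter> elems x)" using finite_subset[OF s cardI(1)] .
      have "\<gamma> \<in> (C - elems \<gamma>) \<inter> elems x" using \<gamma> x(2) mem_irrefl by blast
      then have "1 \<le> card ((C - elems \<gamma>) \<inter> elems x)"
        using f by (auto simp: Suc_le_eq card_gt_0_iff)
      moreover have "card ((C - elems \<gamma>) \<inter> elems x) \<le> Suc n"
        using card_mono[OF cardI(1) s] cardI(2) by linarith
      moreover have "x \<in> C - elems \<gamma>" using x mem_asym by blast
      ultimately have "x \<in> succ_n (Suc n) (C - elems \<gamma>)" unfolding succ_n_eq[OF sub\<kappa>] using f by blast
      then show ?thesis using sub by blast
    qed
    have \<delta>A: "\<delta> \<in> A" using in_A[OF \<delta>(1) \<gamma>\<delta>] by blast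
    have "elems m \<subseteq> elems \<delta>" using Ord_subset[OF Ord_below[OF \<kappa>[OF \<delta>(1)]] mC(2)] .
    then have "m \<in> A" using in_A[OF mC(1) \<gamma>m] by blast
    then have m_bt: "m \<in> elems (bt \<delta>)" using sparse \<delta>A mC(2) by blast
    \<comment> \<open>As \<open>m\<close> is the greatest point of \<open>C\<close> before
      \<open>\<delta>\<close>, it is the supremum that \<open>moves\<close> compares with
      \<open>bt \<delta>\<close>.\<close>
    have "(\<Union>c\<in>C \<inter> elems \<delta>. elems c) = elems m"
    proof (intro equalityI subsetI)
      fix x assume "x \<in> (\<Union>c\<in>C \<inter> elems \<delta>. elems c)"
      then obtain c where c: "c \<in> C" "c \<in> elems \<delta>" "x \<in> elems c" by blast
      have "c \<in> elems m \<or> c = m"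
      proof (cases "c \<in> elems \<gamma>'")
        case True
        then show ?thesis
          using below_linear[OF \<kappa>[OF mC(1)] \<kappa>[OF \<gamma>'(1)]] mC(3) below_trans[OF \<kappa>[OF mC(1)], of c \<gamma>'] by blast
      next
        case False
        then have "c \<in> K" using c by (auto simp: K_def)
        then show ?thesis using m(2) by blast
      qed
      then show "x \<in> elems m" using c(3) below_trans[OF \<kappa>[OF mC(1)]] by blast
    qed (use mC in blast)
    then have "osup (C \<inter> elems \<delta>) = m" using osup_eq_iff[of "C \<inter> elems \<delta>" m] C'(1) by blast
    then have "moves C \<delta>" unfolding moves_def using m_bt \<delta>A A by blast
    then have "pt C \<delta> = bt \<delta>" "val C \<delta> = xv \<delta>" by (simp_all add: pt_def val_def)
    then show ?thesis using \<delta> \<delta>A decode_eq_Some_iff[OF C'(1)] by blast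
  qed
  moreover have "\<gamma> \<in> elems ?y" using pt_gt[OF C'(1) \<gamma> \<gamma>'] .
  moreover have "?y \<in> dom (decode C)" unfolding dom_decode using \<gamma>'(1) by blast
  ultimately show ?thesis by blast
qed

end

section \<open>Transfer of the proxy sequence along decoding\<close>

theorem theorem5p13:
  fixes \<kappa> \<xi> \<mu> \<nu> \<theta> :: "'k hset"
    and \<S> :: "'k hset set set"
    and R :: "'k hset rel_name"
    and B :: "'k hset \<Rightarrow> 'k hset set"
  assumes "regular_uncountable \<kappa>"
    and "|seqs_below \<kappa>| =o |elems \<kappa>|"
    and "Ord \<xi>" "ole \<xi> \<kappa>"
    and "Cardinal \<mu>" "ole \<mu> \<kappa>"
    and "Cardinal \<nu>" "ole \<nu> \<kappa>"
    and "Cardinal \<theta>" "ole \<theta> \<kappa>"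
    and "\<S> \<noteq> {}" "\<forall>S\<in>\<S>. stationary_in \<kappa> S"
    and "R \<in> rel_family"
    and "P_minus \<xi> \<kappa> \<mu> R \<theta> \<S> \<nu>"
    and "is_partition \<kappa> B" "\<forall>\<iota>\<in>elems \<kappa>. stationary_in \<kappa> (B \<iota>)"
  shows "\<exists>\<C> :: 'k hset \<Rightarrow> ('k hset \<rightharpoonup> 'k hset) set. P_bullet_witness \<C> B \<xi> \<kappa> \<mu> R \<theta> \<S> \<nu>"
proof -
  interpret regular_cardinal \<kappa> by standard (rule assms(1))
  obtain bt xv :: "'k hset \<Rightarrow> 'k hset" where xv: "\<forall>\<delta>. xv \<delta> \<in> H \<kappa>"
    and coding: "\<forall>\<beta>\<in>elems \<kappa>. \<forall>x\<in>H \<kappa>. \<exists>\<delta>\<in>acc (elems \<kappa>). ole \<beta> \<delta> \<and> bt \<delta> = \<beta> \<and> xv \<delta> = x"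
    using exists_coding[OF card_H[OF ordIso_imp_ordLeq[OF assms(2)]]] by blast
  interpret ordinal_coding \<kappa> bt xv by standard (use xv in blast)
  obtain \<C> :: "'k hset \<Rightarrow> 'k hset set set" where
    \<C>_all: "\<forall>\<alpha>\<in>acc (elems \<kappa>). \<C> \<alpha> \<subseteq> {C \<in> KK \<kappa>. ole (otp C) \<xi> \<and> osup C = \<alpha>} \<and>
        \<C> \<alpha> \<noteq> {} \<and> |\<C> \<alpha>| <o |elems \<mu>| \<and> (\<forall>C\<in>\<C> \<alpha>. \<forall>\<alpha>'\<in>acc C. \<exists>D\<in>\<C> \<alpha>'. relK R D C)"
    and hit: "\<forall>B. (\<forall>i\<in>elems \<theta>. cofinal_in \<kappa> (B i)) \<longrightarrow>
        (\<forall>S\<in>\<S>. \<forall>n. stationary_in \<kappa> {\<alpha>\<in>S. |\<C> \<alpha>| <o |elems \<nu>| \<and>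
           (\<forall>C\<in>\<C> \<alpha>. \<forall>i\<in>elems \<alpha> \<inter> elems \<theta>. osup {\<gamma>\<in>C. succ_n n (C - elems \<gamma>) \<subseteq> B i} = \<alpha>)})"
    using assms(14) unfolding P_minus_def by (elim exE conjE) (rule that)
  note \<C> = bspec[OF \<C>_all]
  \<comment> \<open>Nothing is known about \<open>\<C> \<alpha>\<close> at other
    \<open>\<alpha>\<close>; with the empty set there, having a member forces
    \<open>\<alpha>\<close> to be a limit.\<close>
  define \<C>' where "\<C>' \<alpha> = (if \<alpha> \<in> acc (elems \<kappa>) then decode ` \<C> \<alpha> else {})" for \<alpha>
  have card: "|\<C>' \<alpha>| \<le>o |\<C> \<alpha>|" for \<alpha>
    unfolding \<C>'_def by (simp add: card_of_image card_of_empty)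
  have KK: "C \<in> KK \<kappa>" "ole (otp C) \<xi>" "osup C = \<alpha>" if "\<alpha> \<in> acc (elems \<kappa>)" "C \<in> \<C> \<alpha>" for \<alpha> C
    using \<C>[OF that(1)] that(2) by auto
  have coherent: "\<exists>E\<in>\<C>' \<alpha>'. relF R E (decode C)"
    if \<alpha>: "\<alpha> \<in> acc (elems \<kappa>)" and C: "C \<in> \<C> \<alpha>" and \<alpha>': "\<alpha>' \<in> acc (dom (decode C))" for \<alpha> C \<alpha>'
  proof -
    have acc: "\<alpha>' \<in> acc C" using acc_dom_decode[OF KK(1)[OF \<alpha> C] \<alpha>'] .
    then obtain D where D: "D \<in> \<C> \<alpha>'" "relK R D C" using \<C>[OF \<alpha>] C by blast
    have C\<kappa>: "C \<subseteq> elems \<kappa>" using KK_D(1)[OF KK(1)[OF \<alpha> C]] .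
    have "\<alpha>' \<in> C" "osup (C \<inter> elems \<alpha>') = \<alpha>'" "ozero \<in> elems \<alpha>'" using acc by (auto simp: acc_def)
    moreover from this have \<alpha>'\<kappa>: "\<alpha>' \<in> elems \<kappa>" using C\<kappa> by blast
    \<comment> \<open>A limit of points of \<open>C\<close> is a limit ordinal, so the hypotheses on
      the sequence apply at \<open>\<alpha>'\<close>.\<close>
    moreover have "osup (elems \<kappa> \<inter> elems \<alpha>') = \<alpha>'"
    proof -
      have "(\<Union>a\<in>C \<inter> elems \<alpha>'. elems a) = elems \<alpha>'"
        using calculation(2) osup_eq_iff[of "C \<inter> elems \<alpha>'" \<alpha>'] C\<kappa> by blast
      then have "elems \<alpha>' \<subseteq> (\<Union>a\<in>elems \<kappa> \<inter> elems \<alpha>'. elems a)" using C\<kappa> by blast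
      moreover have "(\<Union>a\<in>elems \<kappa> \<inter> elems \<alpha>'. elems a) \<subseteq> elems \<alpha>'"
        using below_trans[OF \<alpha>'\<kappa>] by blast
      ultimately show ?thesis using osup_eq_iff[of "elems \<kappa> \<inter> elems \<alpha>'" \<alpha>'] by blast
    qed
    ultimately have lim: "\<alpha>' \<in> acc (elems \<kappa>)" by (simp add: acc_def)
    have "relF R (decode D) (decode C)"
      using rel_decode[OF KK(1)[OF lim D(1)] KK(1)[OF \<alpha> C] D(2)] .
    then show ?thesis using lim D(1) by (auto simp: \<C>'_def)
  qed
  have stat: "stationary_in \<kappa> {\<alpha>\<in>S. |\<C>' \<alpha>| <o |elems \<nu>| \<and>
           (\<forall>C\<in>\<C>' \<alpha>. \<forall>i\<in>elems \<alpha> \<inter> elems \<theta>.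
              osup {\<gamma>\<in>dom C. succ_n n (dom C - elems \<gamma>) \<subseteq> B_hit \<kappa> (B (\<iota> i)) (\<Omega> i) (p i) C} = \<alpha>)}"
    (is "stationary_in \<kappa> ?T")
    if given: "\<forall>i\<in>elems \<theta>. \<Omega> i \<subseteq> H \<kappa> \<and> p i \<in> Hplus \<kappa> \<and> \<iota> i \<in> elems \<kappa>" and S: "S \<in> \<S>" for \<Omega> p \<iota> S n
  proof -
    have "\<forall>i\<in>elems \<theta>. \<exists>A. cofinal_in \<kappa> A \<and> A \<subseteq> acc (elems \<kappa>) \<and>
      (\<forall>\<delta>\<in>A. ole (bt \<delta>) \<delta> \<and> bt \<delta> \<in> B (\<iota> i) \<and>
        (\<exists>M. M \<prec> Hplus \<kappa> \<and> p i \<in> M \<and> M \<inter> elems \<kappa> = elems (bt \<delta>) \<and> M \<inter> \<Omega> i = elems (xv \<delta>))) \<and>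
      (\<forall>\<delta>\<in>A. \<forall>\<delta>'\<in>A. \<delta> \<in> elems \<delta>' \<longrightarrow> \<delta> \<in> elems (bt \<delta>'))"
    proof
      fix i assume i: "i \<in> elems \<theta>"
      then have "p i \<in> Hplus \<kappa>" "\<Omega> i \<subseteq> H \<kappa>" "stationary_in \<kappa> (B (\<iota> i))"
        using given assms(16) by auto
      then show "\<exists>A. cofinal_in \<kappa> A \<and> A \<subseteq> acc (elems \<kappa>) \<and>
      (\<forall>\<delta>\<in>A. ole (bt \<delta>) \<delta> \<and> bt \<delta> \<in> B (\<iota> i) \<and>
        (\<exists>M. M \<prec> Hplus \<kappa> \<and> p i \<in> M \<and> M \<inter> elems \<kappa> = elems (bt \<delta>) \<and> M \<inter> \<Omega> i = elems (xv \<delta>))) \<and>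
      (\<forall>\<delta>\<in>A. \<forall>\<delta>'\<in>A. \<delta> \<in> elems \<delta>' \<longrightarrow> \<delta> \<in> elems (bt \<delta>'))"
        by (rule cofinal_set_of_codes) (use coding in blast)
    qed
    \<comment> \<open>One cofinal set of codes per triple; these are the sets handed to the guessing
      clause of the hypothesis.\<close>
    from bchoice[OF this] obtain A where A: "\<forall>i\<in>elems \<theta>. cofinal_in \<kappa> (A i) \<and> A i \<subseteq> acc (elems \<kappa>) \<and>
      (\<forall>\<delta>\<in>A i. ole (bt \<delta>) \<delta> \<and> bt \<delta> \<in> B (\<iota> i) \<and>
        (\<exists>M. M \<prec> Hplus \<kappa> \<and> p i \<in> M \<and> M \<inter> elems \<kappa> = elems (bt \<delta>) \<and> M \<inter> \<Omega> i = elems (xv \<delta>))) \<and>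
      (\<forall>\<delta>\<in>A i. \<forall>\<delta>'\<in>A i. \<delta> \<in> elems \<delta>' \<longrightarrow> \<delta> \<in> elems (bt \<delta>'))" ..
    \<comment> \<open>\<open>Suc n\<close> rather than \<open>n\<close>, because the first successor
      in each block is lost in decoding.\<close>
    have st: "stationary_in \<kappa> {\<alpha>\<in>S. |\<C> \<alpha>| <o |elems \<nu>| \<and>
      (\<forall>C\<in>\<C> \<alpha>. \<forall>i\<in>elems \<alpha> \<inter> elems \<theta>. osup {\<gamma>\<in>C. succ_n (Suc n) (C - elems \<gamma>) \<subseteq> A i} = \<alpha>)}"
      (is "stationary_in \<kappa> ?U")
      by (rule hit[rule_format, OF _ S]) (use A in blast)
    have "?U \<subseteq> ?T"
    proof
      fix \<alpha> assume \<alpha>: "\<alpha> \<in> ?U"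
      have "|\<C>' \<alpha>| <o |elems \<nu>|" using \<alpha> card[of \<alpha>] ordLeq_ordLess_trans by blast
      moreover have "osup {\<gamma>\<in>dom C'. succ_n n (dom C' - elems \<gamma>) \<subseteq> B_hit \<kappa> (B (\<iota> i)) (\<Omega> i) (p i) C'} = \<alpha>"
        (is "osup ?new = \<alpha>") if C': "C' \<in> \<C>' \<alpha>" and i: "i \<in> elems \<alpha> \<inter> elems \<theta>" for C' i
      proof -
        have lim: "\<alpha> \<in> acc (elems \<kappa>)" using C' by (auto simp: \<C>'_def split: if_splits)
        then obtain C where C: "C \<in> \<C> \<alpha>" "C' = decode C" using C' by (auto simp: \<C>'_def)
        note CK = KK[OF lim C(1)]
        have domK: "dom C' \<in> KK \<kappa>" "osup (dom C') = \<alpha>"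
          using dom_decode_KK[OF CK(1)] osup_dom_decode[OF CK(1)] CK(3) C(2) by auto
        have A1: "A i \<subseteq> acc (elems \<kappa>)"
          and A2: "\<And>\<delta>. \<delta> \<in> A i \<Longrightarrow> ole (bt \<delta>) \<delta> \<and> bt \<delta> \<in> B (\<iota> i) \<and>
            (\<exists>M. M \<prec> Hplus \<kappa> \<and> p i \<in> M \<and> M \<inter> elems \<kappa> = elems (bt \<delta>) \<and> M \<inter> \<Omega> i = elems (xv \<delta>))"
          and A3: "\<And>\<delta> \<delta>'. \<delta> \<in> A i \<Longrightarrow> \<delta>' \<in> A i \<Longrightarrow> \<delta> \<in> elems \<delta>' \<Longrightarrow> \<delta> \<in> elems (bt \<delta>')"
          using A i by auto
        let ?old = "{\<gamma>\<in>C. succ_n (Suc n) (C - elems \<gamma>) \<subseteq> A i}"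
        have old: "osup ?old = \<alpha>" using \<alpha> C(1) i by blast
        have old\<kappa>: "?old \<subseteq> elems \<kappa>" using KK_D(1)[OF CK(1)] by blast
        have new\<kappa>: "?new \<subseteq> elems \<kappa>" using KK_D(1)[OF domK(1)] by blast
        \<comment> \<open>Each \<open>\<gamma>\<close> that is good for \<open>C\<close> is exceeded
          by a point good for the decoded club, so the latter points also have supremum
          \<open>\<alpha>\<close>.\<close>
        have step: "\<exists>y\<in>?new. \<gamma> \<in> elems y" if \<gamma>: "\<gamma> \<in> ?old" for \<gamma>
        proof -
          have "\<gamma> \<in> C" "succ_n (Suc n) (C - elems \<gamma>) \<subseteq> A i" using \<gamma> by auto
          then obtain y where y: "y \<in> dom C'" "\<gamma> \<in> elems y"
            and hits: "\<And>z. z \<in> succ_n n (dom C' - elems y) \<Longrightarrow>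
              \<exists>\<delta>\<in>A i \<inter> C. z = bt \<delta> \<and> C' z = Some (xv \<delta>)"
            using succ_n_decode[OF CK(1) _ _ A1 _ A3, of \<gamma> n] A2 unfolding C(2) by blast
          have "succ_n n (dom C' - elems y) \<subseteq> B_hit \<kappa> (B (\<iota> i)) (\<Omega> i) (p i) C'"
          proof
            fix z assume "z \<in> succ_n n (dom C' - elems y)"
            then obtain \<delta> where \<delta>: "\<delta> \<in> A i" "z = bt \<delta>" "C' z = Some (xv \<delta>)" using hits by blast
            have "the (C' z) = xv \<delta>" "z \<in> dom C'" using \<delta>(3) by auto
            then show "z \<in> B_hit \<kappa> (B (\<iota> i)) (\<Omega> i) (p i) C'"
              unfolding B_hit_def using A2[OF \<delta>(1)] \<delta>(2) by auto
          qed
          then show ?thesis using y by blast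
        qed
        have "(\<Union>a\<in>?new. elems a) = elems \<alpha>"
        proof (intro equalityI subsetI)
          fix x assume "x \<in> (\<Union>a\<in>?new. elems a)"
          then have "x \<in> (\<Union>a\<in>dom C'. elems a)" by blast
          then show "x \<in> elems \<alpha>" using KK_D(4)[OF domK(1)] domK(2) by simp
        next
          fix x assume "x \<in> elems \<alpha>"
          then have "x \<in> (\<Union>a\<in>?old. elems a)" using elems_osup[OF old\<kappa>] old by simp
          then obtain \<gamma> where \<gamma>: "\<gamma> \<in> ?old" "x \<in> elems \<gamma>" by blast
          then obtain y where y: "y \<in> ?new" "\<gamma> \<in> elems y" using step by blast
          have "y \<in> elems \<kappa>" using y(1) new\<kappa> by blast
          then have "x \<in> elems y" using below_trans \<gamma>(2) y(2) by blast
          then show "x \<in> (\<Union>a\<in>?new. elems a)" using y(1) by blast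
        qed
        then show ?thesis using osup_eq_iff[OF new\<kappa>] by blast
      qed
      ultimately show "\<alpha> \<in> ?T" using \<alpha> by blast
    qed
    moreover have "?T \<subseteq> elems \<kappa>" using assms(12) S by (auto simp: stationary_in_def)
    ultimately show ?thesis using st unfolding stationary_in_def by blast
  qed
  have local: "\<C>' \<alpha> \<subseteq> {C \<in> FF \<kappa>. ole (otp (dom C)) \<xi> \<and> osup (dom C) = \<alpha>} \<and>
        \<C>' \<alpha> \<noteq> {} \<and> |\<C>' \<alpha>| <o |elems \<mu>| \<and>
        (\<forall>C\<in>\<C>' \<alpha>. \<forall>\<alpha>'\<in>acc (dom C). \<exists>D\<in>\<C>' \<alpha>'. relF R D C)"
    if \<alpha>: "\<alpha> \<in> acc (elems \<kappa>)" for \<alpha>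
  proof (intro conjI)
    have eq: "\<C>' \<alpha> = decode ` \<C> \<alpha>" using \<alpha> by (simp add: \<C>'_def)
    show "\<C>' \<alpha> \<subseteq> {C \<in> FF \<kappa>. ole (otp (dom C)) \<xi> \<and> osup (dom C) = \<alpha>}"
    proof
      fix C' assume "C' \<in> \<C>' \<alpha>"
      then obtain C where C: "C \<in> \<C> \<alpha>" "C' = decode C" using eq by blast
      note CK = KK[OF \<alpha> C(1)]
      show "C' \<in> {C \<in> FF \<kappa>. ole (otp (dom C)) \<xi> \<and> osup (dom C) = \<alpha>}"
        using decode_FF[OF CK(1)] otp_dom_decode[OF KK_D(1)[OF CK(1)]] osup_dom_decode[OF CK(1)] CK C(2)
        by simp
    qed
    show "\<C>' \<alpha> \<noteq> {}" using eq \<C>[OF \<alpha>] by simp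
    show "|\<C>' \<alpha>| <o |elems \<mu>|" using \<C>[OF \<alpha>] card[of \<alpha>] ordLeq_ordLess_trans by blast
    show "\<forall>C\<in>\<C>' \<alpha>. \<forall>\<alpha>'\<in>acc (dom C). \<exists>D\<in>\<C>' \<alpha>'. relF R D C"
      unfolding eq using coherent[OF \<alpha>] by blast
  qed
  have "P_bullet_witness \<C>' B \<xi> \<kappa> \<mu> R \<theta> \<S> \<nu>"
    unfolding P_bullet_witness_def
  proof (rule conjI[OF assms(15)], rule conjI)
    show "\<forall>\<alpha>\<in>acc (elems \<kappa>). \<C>' \<alpha> \<subseteq> {C \<in> FF \<kappa>. ole (otp (dom C)) \<xi> \<and> osup (dom C) = \<alpha>} \<and>
        \<C>' \<alpha> \<noteq> {} \<and> |\<C>' \<alpha>| <o |elems \<mu>| \<and>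
        (\<forall>C\<in>\<C>' \<alpha>. \<forall>\<alpha>'\<in>acc (dom C). \<exists>D\<in>\<C>' \<alpha>'. relF R D C)"
      by (rule ballI) (rule local)
  qed (intro allI impI ballI, rule stat)
  then show ?thesis by blast
qed

end
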